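(* Let $G$ be a locally compact abelian group. Every almost periodic function $\varphi\in AP(G)$ has an aperiodic realization on some group compactification $(\iota_X,X)$ of $G$.
   Context: $G$ is a locally compact abelian (LCA) group, written additively. A group compactification of $G$ is a pair $(\iota_X,X)$ with $X$ a compact (Hausdorff) group and $\iota_X:G\to X$ a continuous homomorphism with dense image; $\mu_X$ is the normalized Haar measure on $X$, $0_X$ the unit of $X$. $(\iota_b,bG)$ denotes the Bohr compactification of $G$ (the maximal group compactification), and $AP(G):=\{f\circ\iota_b: f\in C(bG)\}$ is the set of almost periodic functions. A bounded function $f:X\to\mathbb{C}$ is Riemann integrable, $f\in R_{\mu_X}(X)$, iff its set of points of discontinuity is a $\mu_X$-null set. A function $\varphi^*$ is a realization of $\varphi:G\to\mathbb{C}$ on $(\iota_X,X)$ iff $\varphi^*\in R_{\mu_X}(X)$ and $\varphi=\varphi^*\circ\iota_X$ (everywhere on $G$). It is aperiodic iff $\{x\in X:\|\varphi^*-\tau_x\varphi^*\|_1=0\}=\{0_X\}$, where $\|\cdot\|_1$ is the $L^1(\mu_X)$-norm and $\tau_x\varphi^*(y)=\varphi^*(x+y)$. *)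

theory Defs
  imports "HOL-Analysis.Analysis" "HOL-Algebra.Group"
begin

text \<open>Groups are written multiplicatively, as in \<^theory>\<open>HOL-Algebra.Group\<close>.\<close>

record 'a topgroup = "'a monoid" +
  gtop :: "'a topology"

definition topological_group :: "'a topgroup \<Rightarrow> bool" where
  "topological_group G \<longleftrightarrow>
     group G \<and> topspace (gtop G) = carrier G \<and>
     continuous_map (prod_topology (gtop G) (gtop G)) (gtop G) (\<lambda>(x, y). x \<otimes>\<^bsub>G\<^esub> y) \<and>
     continuous_map (gtop G) (gtop G) (m_inv G)"

definition LCA_group :: "'a topgroup \<Rightarrow> bool" where
  "LCA_group G \<longleftrightarrow>
     topological_group G \<and> comm_group G \<and>
     Hausdorff_space (gtop G) \<and> locally_compact_space (gtop G)"

definition compact_group :: "'a topgroup \<Rightarrow> bool" where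
  "compact_group X \<longleftrightarrow>
     topological_group X \<and> Hausdorff_space (gtop X) \<and> compact_space (gtop X)"

definition group_compactification ::
    "'g topgroup \<Rightarrow> ('g \<Rightarrow> 'x) \<Rightarrow> 'x topgroup \<Rightarrow> bool" where
  "group_compactification G \<iota> X \<longleftrightarrow>
     compact_group X \<and> \<iota> \<in> hom G X \<and> continuous_map (gtop G) (gtop X) \<iota> \<and>
     gtop X closure_of (\<iota> ` carrier G) = carrier X"

text \<open>
  The Bohr compactification is the maximal group compactification: every group compactification
  is a quotient of it, compatibly with the maps from \<open>G\<close>. HOL cannot quantify over the type of
  the competing compactifications, but \<open>'g set set\<close> accommodates all of them up to isomorphism:
  for any group compactification \<open>(\<iota>, X)\<close> the map sending \<open>x \<in> X\<close> to the family
  \<open>{\<iota> -` U \<inter> carrier G | U. openin (gtop X) U \<and> x \<in> U}\<close> is injective, because \<open>X\<close> is Hausdorff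
  and \<open>\<iota>\<close> has dense image.
\<close>

definition Bohr_compactification ::
    "'g topgroup \<Rightarrow> ('g \<Rightarrow> 'b) \<Rightarrow> 'b topgroup \<Rightarrow> bool" where
  "Bohr_compactification G \<iota>b bG \<longleftrightarrow>
     group_compactification G \<iota>b bG \<and>
     (\<forall>\<iota> (X :: 'g set set topgroup). group_compactification G \<iota> X \<longrightarrow>
        (\<exists>\<pi>. \<pi> \<in> hom bG X \<and> continuous_map (gtop bG) (gtop X) \<pi> \<and>
             (\<forall>g \<in> carrier G. \<iota> g = \<pi> (\<iota>b g))))"

definition almost_periodic ::
    "'g topgroup \<Rightarrow> ('g \<Rightarrow> 'b) \<Rightarrow> 'b topgroup \<Rightarrow> ('g \<Rightarrow> complex) set" where
  "almost_periodic G \<iota>b bG =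
     {\<phi>. \<exists>f. continuous_map (gtop bG) euclidean f \<and> (\<forall>g \<in> carrier G. \<phi> g = f (\<iota>b g))}"

text \<open>
  Outer regularity of a finite Borel measure on a compact Hausdorff space yields inner regularity
  by compact sets on passing to complements.
\<close>

definition is_normalized_Haar :: "'x topgroup \<Rightarrow> 'x measure \<Rightarrow> bool" where
  "is_normalized_Haar X M \<longleftrightarrow>
     space M = carrier X \<and>
     sets M = sigma_sets (carrier X) {U. openin (gtop X) U} \<and>
     emeasure M (carrier X) = 1 \<and>
     (\<forall>x \<in> carrier X. \<forall>A \<in> sets M. emeasure M ((\<lambda>y. x \<otimes>\<^bsub>X\<^esub> y) ` A) = emeasure M A) \<and>
     (\<forall>A \<in> sets M. emeasure M A = (INF U \<in> {U. openin (gtop X) U \<and> A \<subseteq> U}. emeasure M U))"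

text \<open>On a compact group such a measure exists and is unique, so the choice is immaterial.\<close>

definition Haar :: "'x topgroup \<Rightarrow> 'x measure" where
  "Haar X = (SOME M. is_normalized_Haar X M)"

definition Riemann_integrable :: "'x topgroup \<Rightarrow> ('x \<Rightarrow> complex) \<Rightarrow> bool" where
  "Riemann_integrable X f \<longleftrightarrow>
     bounded (f ` carrier X) \<and>
     {x \<in> carrier X. \<not> topcontinuous_at (gtop X) euclidean f x} \<in> null_sets (Haar X)"

definition realization ::
    "'g topgroup \<Rightarrow> ('g \<Rightarrow> 'x) \<Rightarrow> 'x topgroup \<Rightarrow> ('g \<Rightarrow> complex) \<Rightarrow> ('x \<Rightarrow> complex) \<Rightarrow> bool" where
  "realization G \<iota> X \<phi> \<phi>s \<longleftrightarrow>
     Riemann_integrable X \<phi>s \<and> (\<forall>g \<in> carrier G. \<phi> g = \<phi>s (\<iota> g))"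

text \<open>
  A Riemann integrable function need not be Borel measurable, but it is measurable with respect
  to the completion of Haar measure.
\<close>

definition L1_norm :: "'x topgroup \<Rightarrow> ('x \<Rightarrow> complex) \<Rightarrow> real" where
  "L1_norm X f = (LINT y | completion (Haar X). cmod (f y))"

definition translate :: "'x topgroup \<Rightarrow> 'x \<Rightarrow> ('x \<Rightarrow> complex) \<Rightarrow> 'x \<Rightarrow> complex" where
  "translate X x f = (\<lambda>y. f (x \<otimes>\<^bsub>X\<^esub> y))"

definition aperiodic :: "'x topgroup \<Rightarrow> ('x \<Rightarrow> complex) \<Rightarrow> bool" where
  "aperiodic X f \<longleftrightarrow>
     {x \<in> carrier X. L1_norm X (\<lambda>y. f y - translate X x f y) = 0} = {\<one>\<^bsub>X\<^esub>}"

end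

theory Submission
  imports Defs
begin

text \<open>Write \<open>\<phi> = f \<circ> \<iota>b\<close> with \<open>f\<close> continuous on \<open>bG\<close>, and divide \<open>bG\<close> by the closed subgroup of
  periods of \<open>f\<close>; the function induced by \<open>f\<close> on the quotient is continuous and has no period
  but the unit, and since Haar measure charges every nonempty open set it is aperiodic also in the
  \<open>L\<^sup>1\<close> sense. The quotient is metrized by the translation invariant distance
  \<open>sup\<^sub>z \<bar>f (x z) - f (y z)\<bar>\<close>, so its Haar measure can be obtained as a limit of normalized
  covering numbers.\<close>

section \<open>Measures invariant under the isometries of a compact metric space\<close>

text \<open>\<open>Haar\<close> is a choice, so nothing can be said about it until some normalized
  Haar measure of the quotient has been exhibited; this is why a measure is constructed at all. The
  metric reduces that task to one without groups: translations enter only as isometries. Invariance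
  of the distance rests on commutativity, since \<open>w x z = x (w z)\<close> turns a common factor
  of both arguments into another parameter of the supremum. \<open>bG\<close> is not assumed
  abelian, so commutativity is inherited from the dense image of \<open>G\<close>. The other
  constraint is the type: the quotient has to live in \<open>'g set set\<close>, while cosets are
  subsets of \<open>bG\<close>. It is therefore built from an arbitrary map \<open>q\<close> whose
  fibres are the cosets of the period group, and a suitable \<open>q\<close> is supplied at the end
  from traces of balls on \<open>G\<close>.\<close>

locale compact_metric_space = Metric_space +
  assumes compact: "compact_space mtopology" and nonempty: "M \<noteq> {}"
begin

section \<open>Isometries and covering numbers\<close>

definition isometric_bij :: "('a \<Rightarrow> 'a) \<Rightarrow> bool" where
  "isometric_bij T \<longleftrightarrow> bij_betw T M M \<and> (\<forall>x\<in>M. \<forall>y\<in>M. d (T x) (T y) = d x y)"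

lemma isometric_bij_inv:
  assumes "isometric_bij T"
  shows "isometric_bij (inv_into M T)"
proof -
  have T: "bij_betw T M M" "\<And>x y. x \<in> M \<Longrightarrow> y \<in> M \<Longrightarrow> d (T x) (T y) = d x y"
    using assms by (auto simp: isometric_bij_def)
  have "bij_betw (inv_into M T) M M"
    by (rule bij_betw_inv_into [OF T(1)])
  moreover have "d (inv_into M T x) (inv_into M T y) = d x y" if "x \<in> M" "y \<in> M" for x y
    using T(2) [of "inv_into M T x" "inv_into M T y"] that T(1)
    by (simp add: bij_betw_inv_into_right bij_betw_apply [OF bij_betw_inv_into])
  ultimately show ?thesis
    by (auto simp: isometric_bij_def)
qed

text \<open>Intersecting with \<open>M\<close> gives every set of the type a finite cover at each
  positive radius, so the laws of the content mostly hold for arbitrary sets.\<close>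

definition covering_number :: "real \<Rightarrow> 'a set \<Rightarrow> nat" where
  "covering_number \<epsilon> A =
     (LEAST k. \<exists>F. finite F \<and> card F = k \<and> F \<subseteq> M \<and> A \<inter> M \<subseteq> (\<Union>x\<in>F. mball x \<epsilon>))"

lemma covering_number_le:
  assumes "finite F" "F \<subseteq> M" "A \<inter> M \<subseteq> (\<Union>x\<in>F. mball x \<epsilon>)"
  shows "covering_number \<epsilon> A \<le> card F"
  unfolding covering_number_def using assms by (intro Least_le) blast

lemma covering_number_attained:
  assumes "\<epsilon> > 0"
  obtains F where "finite F" "card F = covering_number \<epsilon> A" "F \<subseteq> M" "A \<inter> M \<subseteq> (\<Union>x\<in>F. mball x \<epsilon>)"
proof -
  obtain K where "finite K" "K \<subseteq> M" "M \<subseteq> (\<Union>x\<in>K. mball x \<epsilon>)"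
    using compact assms unfolding compact_space_eq_mcomplete_mtotally_bounded mtotally_bounded_def
    by blast
  then have "\<exists>k F. finite F \<and> card F = k \<and> F \<subseteq> M \<and> A \<inter> M \<subseteq> (\<Union>x\<in>F. mball x \<epsilon>)"
    by blast
  from LeastI_ex [OF this] show thesis
    using that unfolding covering_number_def by blast
qed

lemma covering_number_mono:
  assumes "\<epsilon> > 0" "A \<subseteq> B"
  shows "covering_number \<epsilon> A \<le> covering_number \<epsilon> B"
proof -
  obtain F where "finite F" "card F = covering_number \<epsilon> B" "F \<subseteq> M" "B \<inter> M \<subseteq> (\<Union>x\<in>F. mball x \<epsilon>)"
    using covering_number_attained [OF assms(1)] .
  then show ?thesis
    using covering_number_le [of F A \<epsilon>] assms(2) by fastforce
qed

lemma covering_number_Un: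
  assumes "\<epsilon> > 0"
  shows "covering_number \<epsilon> (A \<union> B) \<le> covering_number \<epsilon> A + covering_number \<epsilon> B"
proof -
  obtain F where F: "finite F" "card F = covering_number \<epsilon> A" "F \<subseteq> M" "A \<inter> M \<subseteq> (\<Union>x\<in>F. mball x \<epsilon>)"
    using covering_number_attained [OF assms] .
  obtain F' where F': "finite F'" "card F' = covering_number \<epsilon> B" "F' \<subseteq> M" "B \<inter> M \<subseteq> (\<Union>x\<in>F'. mball x \<epsilon>)"
    using covering_number_attained [OF assms] .
  have "covering_number \<epsilon> (A \<union> B) \<le> card (F \<union> F')"
    using F F' by (intro covering_number_le) (simp, simp, blast)
  also have "\<dots> \<le> card F + card F'"
    by (rule card_Un_le)
  finally show ?thesis
    using F F' by simp
qed

text \<open>Two points of a ball of radius \<open>\<epsilon>\<close> are less than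
  \<open>2 * \<epsilon>\<close> apart, so no ball meets both sets. An optimal cover of the union
  thus contains disjoint covers of \<open>A\<close> and of \<open>B\<close>.\<close>

lemma covering_number_separated:
  assumes "\<epsilon> > 0" "A \<subseteq> M" "B \<subseteq> M" and sep: "\<And>a b. a \<in> A \<Longrightarrow> b \<in> B \<Longrightarrow> 2 * \<epsilon> \<le> d a b"
  shows "covering_number \<epsilon> A + covering_number \<epsilon> B \<le> covering_number \<epsilon> (A \<union> B)"
proof -
  obtain F where F: "finite F" "card F = covering_number \<epsilon> (A \<union> B)" "F \<subseteq> M"
      "(A \<union> B) \<inter> M \<subseteq> (\<Union>x\<in>F. mball x \<epsilon>)"
    using covering_number_attained [OF assms(1)] .
  define FA where "FA = {x \<in> F. mball x \<epsilon> \<inter> A \<noteq> {}}"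
  define FB where "FB = {x \<in> F. mball x \<epsilon> \<inter> B \<noteq> {}}"
  have "covering_number \<epsilon> A \<le> card FA"
    using F unfolding FA_def by (intro covering_number_le) (simp, blast, blast)
  moreover have "covering_number \<epsilon> B \<le> card FB"
    using F unfolding FB_def by (intro covering_number_le) (simp, blast, blast)
  moreover have "FA \<inter> FB = {}"
  proof -
    have False if x: "x \<in> M" and a: "a \<in> A" "a \<in> M" "d x a < \<epsilon>" and b: "b \<in> B" "b \<in> M" "d x b < \<epsilon>"
      for x a b
      using sep [OF a(1) b(1)] triangle'' [OF a(2) x b(2)] a b by linarith
    then show ?thesis
      by (auto simp: FA_def FB_def)
  qed
  then have "card FA + card FB = card (FA \<union> FB)"
    using F(1) by (subst card_Un_disjoint) (auto simp: FA_def FB_def)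
  moreover have "card (FA \<union> FB) \<le> card F"
    using F(1) by (intro card_mono) (auto simp: FA_def FB_def)
  ultimately show ?thesis
    using F(2) by linarith
qed

lemma covering_number_isometric_image:
  assumes "\<epsilon> > 0" "isometric_bij T" "A \<subseteq> M"
  shows "covering_number \<epsilon> (T ` A) \<le> covering_number \<epsilon> A"
proof -
  have T: "T ` M = M" "\<And>x y. x \<in> M \<Longrightarrow> y \<in> M \<Longrightarrow> d (T x) (T y) = d x y"
    using assms(2) by (auto simp: isometric_bij_def bij_betw_def)
  obtain F where F: "finite F" "card F = covering_number \<epsilon> A" "F \<subseteq> M" "A \<inter> M \<subseteq> (\<Union>x\<in>F. mball x \<epsilon>)"
    using covering_number_attained [OF assms(1)] .
  have "T ` A \<inter> M \<subseteq> (\<Union>x\<in>T ` F. mball x \<epsilon>)"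
  proof clarify
    fix a assume "a \<in> A"
    then obtain x where "x \<in> F" "a \<in> mball x \<epsilon>"
      using F(4) assms(3) by blast
    then show "T a \<in> (\<Union>x\<in>T ` F. mball x \<epsilon>)"
      using T F(3) by (intro UN_I [of "T x"]) auto
  qed
  then have "covering_number \<epsilon> (T ` A) \<le> card (T ` F)"
    using F T(1) by (intro covering_number_le) (simp, blast, simp)
  also have "\<dots> \<le> card F"
    using F(1) by (rule card_image_le)
  finally show ?thesis
    using F(2) by simp
qed

lemma covering_number_pos:
  assumes "\<epsilon> > 0"
  shows "covering_number \<epsilon> M > 0"
proof -
  obtain F where F: "finite F" "card F = covering_number \<epsilon> M" "F \<subseteq> M" "M \<inter> M \<subseteq> (\<Union>x\<in>F. mball x \<epsilon>)"
    using covering_number_attained [OF assms] .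
  then show ?thesis
    using nonempty by (metis Int_absorb UN_empty card_gt_0_iff subset_empty)
qed

end

text \<open>Additivity is only asked of sets at positive distance, and subadditivity only of two
  sets: \<open>l\<close> is not yet an outer measure. For isometries an inequality suffices, the
  inverse isometry giving the converse.\<close>

locale invariant_content = compact_metric_space +
  fixes l :: "'a set \<Rightarrow> real"
  assumes l_nonneg: "0 \<le> l A"
    and l_mono: "A \<subseteq> B \<Longrightarrow> l A \<le> l B"
    and l_Un: "l (A \<union> B) \<le> l A + l B"
    and l_separated: "\<lbrakk>\<delta> > 0; A \<subseteq> M; B \<subseteq> M; \<And>a b. a \<in> A \<Longrightarrow> b \<in> B \<Longrightarrow> \<delta> \<le> d a b\<rbrakk>
                        \<Longrightarrow> l A + l B \<le> l (A \<union> B)"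
    and l_space: "l M = 1"
    and l_isometric_image: "\<lbrakk>isometric_bij T; A \<subseteq> M\<rbrakk> \<Longrightarrow> l (T ` A) \<le> l A"

text \<open>The content is a cluster point, in a product of copies of the unit interval, of the relative
  covering numbers at scale \<open>1 / n\<close>: these are only additive on sets at distance at least
  \<open>2 / n\<close>, a restriction that disappears in the limit.\<close>

lemma (in compact_metric_space) invariant_content_exists:
  "\<exists>l. invariant_content M d l"
proof -
  define r :: "nat \<Rightarrow> real" where "r n = 1 / real (Suc n)" for n
  have r: "r n > 0" for n
    by (simp add: r_def)
  define h :: "nat \<Rightarrow> 'a set \<Rightarrow> real"
    where "h n A = real (covering_number (r n) A) / real (covering_number (r n) M)" for n A
  have pos: "real (covering_number (r n) M) > 0" for n
    using covering_number_pos [OF r] by simp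
  have h1: "h n A \<in> {0..1}" for n A
  proof -
    have "covering_number (r n) A = covering_number (r n) (A \<inter> M)"
      by (simp add: covering_number_def Int_assoc)
    also have "\<dots> \<le> covering_number (r n) M"
      by (intro covering_number_mono r) auto
    finally show ?thesis
      using pos [of n] by (simp add: h_def field_simps)
  qed
  have "compactin (product_topology (\<lambda>_. euclidean) UNIV) (PiE UNIV (\<lambda>_::'a set. {0..1::real}))"
    unfolding compactin_PiE by simp
  then have "compact (PiE UNIV (\<lambda>_::'a set. {0..1::real}))"
    by (simp add: euclidean_product_topology)
  \<comment> \<open>The coordinates are indexed by all subsets of the type, so a convergent
    subsequence of \<open>h\<close> need not exist; a cluster point always does.\<close>
  then have "\<exists>l \<in> PiE UNIV (\<lambda>_::'a set. {0..1::real}). inf (nhds l) (filtermap h sequentially) \<noteq> bot"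
    unfolding compact_filter using h1
    by (auto simp: filtermap_bot_iff eventually_filtermap PiE_UNIV_domain)
  then obtain l where l: "inf (nhds l) (filtermap h sequentially) \<noteq> bot"
    by blast
  \<comment> \<open>A closed condition that holds eventually along \<open>h\<close> holds at the
    cluster point. All the laws of a content are of this kind, being weak inequalities between sums
    of finitely many coordinates.\<close>
  have lim: "l \<in> S" if "closed S" "\<forall>\<^sub>F n in sequentially. h n \<in> S" for S
  proof (rule ccontr)
    assume "l \<notin> S"
    then have "\<forall>\<^sub>F x in nhds l. x \<notin> S"
      using that(1) unfolding eventually_nhds by (intro exI [of _ "- S"]) auto
    moreover have "\<forall>\<^sub>F x in filtermap h sequentially. x \<in> S"
      using that(2) by (simp add: eventually_filtermap)
    ultimately have "\<forall>\<^sub>F x in inf (nhds l) (filtermap h sequentially). False"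
      unfolding eventually_inf by (metis (mono_tags, lifting))
    with l show False
      by (simp add: trivial_limit_def)
  qed
  have lim_le: "u l \<le> v l"
    if "continuous_on UNIV u" "continuous_on UNIV v" "\<forall>\<^sub>F n in sequentially. u (h n) \<le> v (h n)"
    for u v :: "('a set \<Rightarrow> real) \<Rightarrow> real"
    using lim [of "{x. u x \<le> v x}"] that by (auto intro: closed_Collect_le)
  have coord: "continuous_on UNIV (\<lambda>x::'a set \<Rightarrow> real. x A)" for A
    by (rule continuous_on_product_coordinates)
  show ?thesis
  proof (rule exI [of _ l], intro invariant_content.intro invariant_content_axioms.intro
      compact_metric_space_axioms)
    show "0 \<le> l A" for A
      using h1 by (intro lim_le [of "\<lambda>_. 0" "\<lambda>x. x A"] coord continuous_on_const) auto
    show "l A \<le> l B" if "A \<subseteq> B" for A B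
      using covering_number_mono [OF r that]
      by (intro lim_le [of "\<lambda>x. x A" "\<lambda>x. x B"] coord) (auto simp: h_def divide_right_mono)
    show "l (A \<union> B) \<le> l A + l B" for A B
    proof (intro lim_le [of "\<lambda>x. x (A \<union> B)" "\<lambda>x. x A + x B"] continuous_on_add coord always_eventually allI)
      show "h n (A \<union> B) \<le> h n A + h n B" for n
        using covering_number_Un [OF r, of n A B]
        by (simp add: h_def flip: add_divide_distrib of_nat_add) (simp add: divide_right_mono)
    qed
    show "l A + l B \<le> l (A \<union> B)"
      if "\<delta> > 0" "A \<subseteq> M" "B \<subseteq> M" "\<And>a b. a \<in> A \<Longrightarrow> b \<in> B \<Longrightarrow> \<delta> \<le> d a b" for \<delta> A B
    proof (intro lim_le [of "\<lambda>x. x A + x B" "\<lambda>x. x (A \<union> B)"] continuous_on_add coord)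
      have "\<delta> / 2 > 0"
        using that(1) by simp
      then obtain N where N: "1 / real (Suc N) < \<delta> / 2"
        by (rule nat_approx_posE)
      show "\<forall>\<^sub>F n in sequentially. h n A + h n B \<le> h n (A \<union> B)"
      proof (rule eventually_sequentiallyI)
        fix n assume "N \<le> n"
        then have "r n \<le> 1 / real (Suc N)"
          by (simp add: r_def frac_le)
        with N have "2 * r n \<le> \<delta>"
          by linarith
        then have "covering_number (r n) A + covering_number (r n) B \<le> covering_number (r n) (A \<union> B)"
          using that by (intro covering_number_separated r) force+
        then show "h n A + h n B \<le> h n (A \<union> B)"
          by (simp add: h_def flip: add_divide_distrib of_nat_add) (simp add: divide_right_mono)
      qed
    qed
    have "h n M = 1" for n
      using pos [of n] by (simp add: h_def)
    then show "l M = 1"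
      by (intro antisym lim_le [of "\<lambda>_. 1" "\<lambda>x. x M"] lim_le [of "\<lambda>x. x M" "\<lambda>_. 1"]
            coord continuous_on_const) auto
    show "l (T ` A) \<le> l A" if "isometric_bij T" "A \<subseteq> M" for T A
      using covering_number_isometric_image [OF r that]
      by (intro lim_le [of "\<lambda>x. x (T ` A)" "\<lambda>x. x A"] coord) (auto simp: h_def divide_right_mono)
  qed
qed

section \<open>From the content to a regular Borel measure\<close>

context invariant_content
begin

text \<open>For open \<open>U\<close> this amounts to the closure of \<open>A\<close> lying in
  \<open>U\<close>, by compactness. The uniform \<open>\<delta>\<close> is what produces the
  positive distances that additivity of \<open>l\<close> demands.\<close>

definition well_inside :: "'a set \<Rightarrow> 'a set \<Rightarrow> bool" where
  "well_inside A U \<longleftrightarrow> A \<subseteq> M \<and> (\<exists>\<delta>>0. \<forall>x\<in>A. mball x \<delta> \<subseteq> U)"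

text \<open>Approximation from inside, followed by approximation from outside in
  \<open>outer\<close>, is the classical passage from a content to a regular measure. It is needed
  because \<open>l\<close> itself is only finitely subadditive.\<close>

definition open_content :: "'a set \<Rightarrow> ennreal" where
  "open_content U = (SUP A\<in>{A. well_inside A U}. ennreal (l A))"

definition outer :: "'a set \<Rightarrow> ennreal" where
  "outer E = (INF U\<in>{U. openin mtopology U \<and> E \<subseteq> U}. open_content U)"

lemma well_inside_subset: "well_inside A U \<Longrightarrow> A \<subseteq> U"
  unfolding well_inside_def by (meson centre_in_mball_iff subsetD subsetI)

lemma well_inside_mono: "well_inside A U \<Longrightarrow> B \<subseteq> A \<Longrightarrow> U \<subseteq> V \<Longrightarrow> well_inside B V"
  unfolding well_inside_def by (meson dual_order.trans subsetD)

lemma well_inside_empty: "well_inside {} U"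
  by (auto simp: well_inside_def intro: exI [of _ 1])

lemma well_inside_Un:
  assumes "well_inside A U" "well_inside B U"
  shows "well_inside (A \<union> B) U"
proof -
  obtain \<delta> \<delta>' where "\<delta> > 0" "\<delta>' > 0" "\<forall>x\<in>A. mball x \<delta> \<subseteq> U" "\<forall>x\<in>B. mball x \<delta>' \<subseteq> U"
    using assms unfolding well_inside_def by blast
  then have "\<forall>x\<in>A \<union> B. mball x (min \<delta> \<delta>') \<subseteq> U" "min \<delta> \<delta>' > 0"
    by (fastforce simp: subset_iff)+
  then show ?thesis
    using assms unfolding well_inside_def by blast
qed

text \<open>The empty set is vacuously at distance at least 1 from itself, so
  \<open>l {} + l {} \<le> l {}\<close>.\<close>

lemma l_empty: "l {} = 0"
  using l_separated [of 1 "{}" "{}"] l_nonneg [of "{}"] by simp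

lemma l_UN_le: "finite I \<Longrightarrow> l (\<Union>i\<in>I. A i) \<le> (\<Sum>i\<in>I. l (A i))"
proof (induction I rule: finite_induct)
  case (insert i I)
  then show ?case
    using l_Un [of "A i" "\<Union>i\<in>I. A i"] by simp
qed (simp add: l_empty)

lemma le_open_content: "well_inside A U \<Longrightarrow> ennreal (l A) \<le> open_content U"
  unfolding open_content_def by (auto intro: SUP_upper)

lemma open_content_mono: "U \<subseteq> V \<Longrightarrow> open_content U \<le> open_content V"
  unfolding open_content_def by (intro SUP_subset_mono) (auto intro: well_inside_mono)

lemma open_content_space: "open_content M = 1"
proof (rule antisym)
  show "open_content M \<le> 1"
    unfolding open_content_def using l_mono [of _ M] l_space
    by (auto intro!: SUP_least simp: well_inside_def)
  have "well_inside M M"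
    by (auto simp: well_inside_def intro: exI [of _ 1])
  then show "1 \<le> open_content M"
    using le_open_content [of M M] l_space by simp
qed

lemma open_content_empty: "open_content {} = 0"
proof -
  have "A = {}" if "well_inside A {}" for A
    using well_inside_subset [OF that] by simp
  then show ?thesis
    unfolding open_content_def
    by (intro antisym SUP_least) (fastforce simp: l_empty)+
qed

lemma open_content_UN_le:
  fixes U :: "nat \<Rightarrow> 'a set"
  assumes U: "\<And>i. openin mtopology (U i)"
  shows "open_content (\<Union>i. U i) \<le> (\<Sum>i. open_content (U i))"
  unfolding open_content_def [of "\<Union>i. U i"]
proof (rule SUP_least, clarify)
  fix A assume A: "well_inside A (\<Union>i. U i)"
  \<comment> \<open>The open sets \<open>V i n\<close> are well inside \<open>U i\<close> and exhaust it, so that by compactness of the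
    closure of \<open>A\<close> a single \<open>n\<close> and finitely many \<open>i\<close> suffice to cover \<open>A\<close>.\<close>
  define V where "V i n = {x \<in> M. \<exists>\<epsilon>>1 / real (Suc n). mball x \<epsilon> \<subseteq> U i}" for i n
  \<comment> \<open>The strict inequality in \<open>V\<close> leaves room: a point at distance less
    than \<open>r\<close> from \<open>x\<close> keeps the radius \<open>\<epsilon> - r\<close>,
    still above \<open>1 / Suc n\<close>.\<close>
  have openV: "openin mtopology (V i n)" for i n
    unfolding openin_mtopology
  proof (intro conjI allI impI)
    fix x assume "x \<in> V i n"
    then obtain \<epsilon> where \<epsilon>: "x \<in> M" "\<epsilon> > 1 / real (Suc n)" "mball x \<epsilon> \<subseteq> U i"
      by (auto simp: V_def)
    then obtain r where r: "r > 0" "\<epsilon> - r > 1 / real (Suc n)"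
      using dense [of 0 "\<epsilon> - 1 / real (Suc n)"] by (metis diff_gt_0_iff_gt less_diff_eq add.commute)
    have "mball y (\<epsilon> - r) \<subseteq> mball x \<epsilon>" if "y \<in> mball x r" for y
      using that commute by (intro mball_subset) auto
    then have "mball x r \<subseteq> V i n"
      using r(2) \<epsilon>(3) unfolding V_def
      by (intro subsetI CollectI conjI exI [of _ "\<epsilon> - r"]) (simp, simp, blast)
    with r(1) show "\<exists>r>0. mball x r \<subseteq> V i n"
      by blast
  qed (auto simp: V_def)
  have inside: "well_inside (V i n) (U i)" for i n
    unfolding well_inside_def
  proof (intro conjI exI ballI)
    show "0 < 1 / real (Suc n)"
      by simp
    show "mball x (1 / real (Suc n)) \<subseteq> U i" if x: "x \<in> V i n" for x
    proof -
      obtain \<epsilon> where "1 / real (Suc n) < \<epsilon>" "mball x \<epsilon> \<subseteq> U i"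
        using x unfolding V_def by blast
      then show ?thesis
        using mball_subset_concentric [of "1 / real (Suc n)" \<epsilon> x] by simp
    qed
  qed (auto simp: V_def)
  have V_mono: "V i m \<subseteq> V i n" if "m \<le> n" for i m n
  proof -
    have "1 / real (Suc n) \<le> 1 / real (Suc m)"
      using that by (simp add: frac_le)
    then show ?thesis
      unfolding V_def using order.strict_trans1 by blast
  qed
  \<comment> \<open>A single increasing family replaces the two indices, so the largest member of a
    finite subcover contains the others. A point of \<open>V i n\<close> lies in
    \<open>W (max i n)\<close>: the index must bound \<open>i\<close> and the scale must be at least
    as fine as \<open>n\<close>.\<close>
  define W where "W n = (\<Union>i\<le>n. V i n)" for n
  have W_mono: "W m \<subseteq> W n" if "m \<le> n" for m n
    using V_mono [OF that] that unfolding W_def by fastforce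
  let ?C = "mtopology closure_of A"
  \<comment> \<open>The closure of \<open>A\<close> stays within the union because every point of it
    lies in a ball of radius \<open>\<delta>\<close> around a point of \<open>A\<close>. Adding the
    complement of the closure to each \<open>W n\<close> turns this into an open cover of the whole
    compact space.\<close>
  have cl: "?C \<subseteq> (\<Union>n. W n)"
  proof
    fix x assume x: "x \<in> ?C"
    obtain \<delta> where \<delta>: "\<delta> > 0" "\<And>a. a \<in> A \<Longrightarrow> mball a \<delta> \<subseteq> (\<Union>i. U i)"
      using A by (auto simp: well_inside_def)
    have xM: "x \<in> M"
      using x by (auto simp: metric_closure_of)
    obtain a where "a \<in> A" "a \<in> mball x \<delta>"
      using x \<delta>(1) unfolding metric_closure_of by blast
    then have "x \<in> mball a \<delta>"
      by (auto simp: commute)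
    then obtain i where "x \<in> U i"
      using \<delta>(2) [OF \<open>a \<in> A\<close>] by blast
    then obtain \<epsilon> where \<epsilon>: "\<epsilon> > 0" "mball x \<epsilon> \<subseteq> U i"
      using U [of i] unfolding openin_mtopology by blast
    obtain n where "1 / real (Suc n) < \<epsilon>"
      using \<epsilon>(1) by (rule nat_approx_posE)
    with \<epsilon> xM have "x \<in> V i n"
      unfolding V_def by blast
    then have "x \<in> V i (max i n)"
      using V_mono [of n "max i n" i] by auto
    then show "x \<in> (\<Union>n. W n)"
      unfolding W_def by (metis UN_I UNIV_I atMost_iff max.cobounded1)
  qed
  let ?\<U> = "range (\<lambda>n. W n \<union> (M - ?C))"
  have "\<exists>\<F>. finite \<F> \<and> \<F> \<subseteq> ?\<U> \<and> topspace mtopology \<subseteq> \<Union>\<F>"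
  proof (rule compact [unfolded compact_space_alt, rule_format], intro conjI ballI)
    fix S assume "S \<in> ?\<U>"
    then show "openin mtopology S"
      unfolding W_def by (auto intro!: openin_Un openin_Union openV openin_diff)
  qed (use cl in auto)
  then obtain \<F> where "finite \<F>" "\<F> \<subseteq> ?\<U>" "M \<subseteq> \<Union>\<F>"
    by auto
  then obtain I where I: "finite I" "M \<subseteq> (\<Union>n\<in>I. W n \<union> (M - ?C))"
    using finite_subset_image [of \<F>] by metis
  \<comment> \<open>The inserted 0 makes \<open>Max\<close> meaningful without a separate proof that
    \<open>I\<close> is nonempty.\<close>
  define N where "N = Max (insert 0 I)"
  have "A \<subseteq> W N"
  proof
    fix a assume "a \<in> A"
    moreover have "A \<subseteq> M"
      using A by (simp add: well_inside_def)
    moreover have "A \<subseteq> ?C"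
      using \<open>A \<subseteq> M\<close> by (simp add: closure_of_subset)
    ultimately obtain n where "n \<in> I" "a \<in> W n"
      using I(2) by blast
    then show "a \<in> W N"
      using W_mono [of n N] I(1) by (auto simp: N_def)
  qed
  then have "l A \<le> l (\<Union>i\<le>N. V i N)"
    unfolding W_def by (rule l_mono)
  also have "\<dots> \<le> (\<Sum>i\<le>N. l (V i N))"
    by (rule l_UN_le) simp
  finally have "ennreal (l A) \<le> (\<Sum>i\<le>N. ennreal (l (V i N)))"
    using l_nonneg by (simp add: ennreal_leI sum_ennreal)
  also have "\<dots> \<le> (\<Sum>i\<le>N. open_content (U i))"
    by (intro sum_mono le_open_content inside)
  also have "\<dots> \<le> (\<Sum>i. open_content (U i))"
    by (intro sum_le_suminf) auto
  finally show "ennreal (l A) \<le> (\<Sum>i. open_content (U i))" .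
qed

lemma outer_open: "openin mtopology U \<Longrightarrow> outer U = open_content U"
  unfolding outer_def by (intro antisym INF_lower INF_greatest open_content_mono) auto

lemma outer_mono: "E \<subseteq> E' \<Longrightarrow> outer E \<le> outer E'"
  unfolding outer_def by (intro INF_superset_mono) auto

lemma outer_UN_le:
  fixes E :: "nat \<Rightarrow> 'a set"
  assumes "\<And>i. E i \<subseteq> M"
  shows "outer (\<Union>i. E i) \<le> (\<Sum>i. outer (E i))"
proof (rule ennreal_le_epsilon)
  fix e :: real assume e: "e > 0"
  \<comment> \<open>Since \<open>E i \<subseteq> M\<close>, its outer value is at most 1; being
    finite, it is strictly increased by the error term, so the infimum is undercut by some open set.
    The errors sum to \<open>e\<close>.\<close>
  have "\<exists>U. openin mtopology U \<and> E i \<subseteq> U \<and> open_content U \<le> outer (E i) + ennreal (e * (1/2) ^ Suc i)" for i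
  proof -
    have "outer (E i) \<le> open_content M"
      using outer_mono [OF assms [of i]] outer_open [OF open_in_mspace] by simp
    then have "outer (E i) \<noteq> \<infinity>"
      unfolding open_content_space by (auto simp: top_unique)
    then have "outer (E i) < outer (E i) + ennreal (e * (1/2) ^ Suc i)"
      using e by (cases "outer (E i)")
        (auto intro!: ennreal_lessI add_nonneg_pos simp flip: ennreal_plus)
    then show ?thesis
      unfolding outer_def [of "E i"] INF_less_iff by (auto intro: less_imp_le)
  qed
  then obtain U where U: "\<And>i. openin mtopology (U i)" "\<And>i. E i \<subseteq> U i"
      "\<And>i. open_content (U i) \<le> outer (E i) + ennreal (e * (1/2) ^ Suc i)"
    by metis
  have "outer (\<Union>i. E i) \<le> open_content (\<Union>i. U i)"
    unfolding outer_def using U by (intro INF_lower) (auto intro!: openin_Union)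
  also have "\<dots> \<le> (\<Sum>i. open_content (U i))"
    by (rule open_content_UN_le [OF U(1)])
  also have "\<dots> \<le> (\<Sum>i. outer (E i) + ennreal (e * (1/2) ^ Suc i))"
    by (intro suminf_le U) auto
  also have "\<dots> = (\<Sum>i. outer (E i)) + (\<Sum>i. ennreal (e * (1/2) ^ Suc i))"
    by (rule suminf_add [symmetric]) auto
  also have "(\<Sum>i. ennreal (e * (1/2) ^ Suc i)) = ennreal e"
  proof (rule suminf_ennreal_eq)
    show "(\<lambda>i. e * (1/2) ^ Suc i) sums e"
      using sums_mult [OF power_half_series, of e] by simp
  qed (use e in auto)
  finally show "outer (\<Union>i. E i) \<le> (\<Sum>i. outer (E i)) + ennreal e" .
qed

text \<open>\<open>A\<close> has positive distance from every set well inside \<open>V - closure A\<close>, so the content is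
  additive on the two. Together with \<open>V \<inter> U\<close> being exhausted by such sets \<open>A\<close>, this yields the
  Caratheodory condition for the open set \<open>U\<close>.\<close>

lemma open_content_split:
  assumes V: "openin mtopology V" and A: "well_inside A (V \<inter> U)"
  shows "ennreal (l A) + open_content (V - mtopology closure_of A) \<le> open_content V"
proof -
  have "ennreal (l A) + open_content (V - mtopology closure_of A) =
          (SUP B\<in>{B. well_inside B (V - mtopology closure_of A)}. ennreal (l A) + ennreal (l B))"
    unfolding open_content_def using well_inside_empty
    by (subst ennreal_SUP_add_right) auto
  also have "\<dots> \<le> open_content V"
  proof (rule SUP_least, clarify)
    fix B assume B: "well_inside B (V - mtopology closure_of A)"
    obtain \<delta> where \<delta>: "\<delta> > 0" "\<And>b. b \<in> B \<Longrightarrow> mball b \<delta> \<subseteq> V - mtopology closure_of A"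
      using B by (auto simp: well_inside_def)
    have M: "A \<subseteq> M" "B \<subseteq> M"
      using A B by (auto simp: well_inside_def)
    then have "A \<subseteq> mtopology closure_of A"
      by (simp add: closure_of_subset)
    then have "\<delta> \<le> d a b" if "a \<in> A" "b \<in> B" for a b
      using \<delta>(2) [OF that(2)] that M commute [of a b] by (force simp: subset_iff)
    then have "l A + l B \<le> l (A \<union> B)"
      using \<delta>(1) M by (intro l_separated) auto
    then have "ennreal (l A) + ennreal (l B) \<le> ennreal (l (A \<union> B))"
      using l_nonneg by (simp add: ennreal_leI flip: ennreal_plus)
    also have "\<dots> \<le> open_content V"
      by (intro le_open_content well_inside_Un well_inside_mono [OF A] well_inside_mono [OF B]) auto
    finally show "ennreal (l A) + ennreal (l B) \<le> open_content V" .
  qed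
  finally show ?thesis .
qed

lemma outer_split_open:
  assumes U: "openin mtopology U"
  shows "outer (E \<inter> U) + outer (E - U) \<le> outer E"
  unfolding outer_def [of E]
proof (rule INF_greatest, clarify)
  fix V assume V: "openin mtopology V" "E \<subseteq> V"
  have "outer (E \<inter> U) \<le> open_content (V \<inter> U)"
    using V U by (metis Int_mono openin_Int order_refl outer_mono outer_open)
  moreover have "open_content (V \<inter> U) + outer (E - U) \<le> open_content V"
  proof -
    have "open_content (V \<inter> U) + outer (E - U) =
            (SUP A\<in>{A. well_inside A (V \<inter> U)}. ennreal (l A) + outer (E - U))"
      unfolding open_content_def using well_inside_empty
      by (subst ennreal_SUP_add_left) auto
    also have "\<dots> \<le> open_content V"
    proof (rule SUP_least, clarify)
      fix A assume A: "well_inside A (V \<inter> U)"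
      have "mtopology closure_of A \<subseteq> U"
      proof
        fix x assume x: "x \<in> mtopology closure_of A"
        obtain \<delta> where \<delta>: "\<delta> > 0" "\<And>a. a \<in> A \<Longrightarrow> mball a \<delta> \<subseteq> V \<inter> U"
          using A by (auto simp: well_inside_def)
        obtain a where "a \<in> A" "a \<in> mball x \<delta>"
          using x \<delta>(1) unfolding metric_closure_of by blast
        then have "x \<in> mball a \<delta>"
          by (auto simp: commute)
        then show "x \<in> U"
          using \<delta>(2) [OF \<open>a \<in> A\<close>] by blast
      qed
      then have "outer (E - U) \<le> outer (V - mtopology closure_of A)"
        using V(2) by (intro outer_mono) auto
      also have "\<dots> = open_content (V - mtopology closure_of A)"
        by (intro outer_open openin_diff V closedin_closure_of)
      finally have "ennreal (l A) + outer (E - U) \<le>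
                      ennreal (l A) + open_content (V - mtopology closure_of A)"
        by (rule add_left_mono)
      also have "\<dots> \<le> open_content V"
        by (rule open_content_split [OF V(1) A])
      finally show "ennreal (l A) + outer (E - U) \<le> open_content V" .
    qed
    finally show ?thesis .
  qed
  ultimately show "outer (E \<inter> U) + outer (E - U) \<le> open_content V"
    by (meson add_right_mono order_trans)
qed

lemma openin_mtopology_subset_Pow: "{U. openin mtopology U} \<subseteq> Pow M"
  by (auto simp: openin_mtopology)

lemma outer_empty: "outer {} = 0"
  by (simp add: outer_open open_content_empty)

lemma outer_measure_space_outer: "outer_measure_space (Pow M) outer"
  unfolding outer_measure_space_def positive_def increasing_def countably_subadditive_def
  using outer_empty outer_mono outer_UN_le by (auto simp: image_subset_iff)

text \<open>Caratheodory's theorem makes \<open>outer\<close> a measure on the sets that split every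
  subset of \<open>M\<close> additively. By \<open>outer_split_open\<close> the open sets are among
  them, hence so are all Borel sets, to which the measure is then restricted.\<close>

lemma measure_space_outer:
  "measure_space M (sigma_sets M {U. openin mtopology U}) outer"
proof -
  interpret P: sigma_algebra M "Pow M"
    by (rule sigma_algebra_Pow)
  have ms: "measure_space M (lambda_system M (Pow M) outer) outer"
    by (rule P.caratheodory_lemma [OF outer_measure_space_outer])
  have "U \<in> lambda_system M (Pow M) outer" if U: "openin mtopology U" for U
    unfolding lambda_system_def
  proof (intro CollectI conjI ballI)
    show "U \<in> Pow M"
      using openin_mtopology_subset_Pow U by blast
    fix E assume "E \<in> Pow M"
    then have E: "E \<subseteq> M"
      by simp
    have eq: "U \<inter> E = E \<inter> U" "(M - U) \<inter> E = E - U"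
      using E by auto
    have "outer E \<le> outer (E \<inter> U) + outer (E - U)"
      using P.countably_subadditive_subadditive [of outer] outer_measure_space_outer E
        subadditiveD [of "Pow M" outer "E \<inter> U" "E - U"]
      unfolding outer_measure_space_def by (simp add: Int_Diff_Un Int_Diff_disjoint le_infI1 subset_iff)
    then show "outer (U \<inter> E) + outer ((M - U) \<inter> E) = outer E"
      unfolding eq using outer_split_open [OF U, of E] by (rule antisym [rotated])
  qed
  then have "sigma_sets M {U. openin mtopology U} \<subseteq> lambda_system M (Pow M) outer"
    using ms by (intro sigma_algebra.sigma_sets_subset) (auto simp: measure_space_def)
  moreover have "sigma_algebra M (sigma_sets M {U. openin mtopology U})"
    by (rule sigma_algebra_sigma_sets [OF openin_mtopology_subset_Pow])
  ultimately show ?thesis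
    using measure_down [OF ms] by blast
qed

section \<open>Invariance of the measure under isometries\<close>

lemma isometric_bij_image_mball:
  assumes "isometric_bij T" "x \<in> M"
  shows "T ` mball x \<epsilon> = mball (T x) \<epsilon>"
proof -
  have T: "T ` M = M" "\<And>x y. x \<in> M \<Longrightarrow> y \<in> M \<Longrightarrow> d (T x) (T y) = d x y"
    using assms(1) by (auto simp: isometric_bij_def bij_betw_def)
  have "z \<in> T ` mball x \<epsilon>" if "z \<in> mball (T x) \<epsilon>" for z
  proof -
    have "z \<in> T ` M"
      using that T(1) by simp
    then obtain w where "w \<in> M" "z = T w"
      by blast
    then show ?thesis
      using that T(2) assms(2) by auto
  qed
  moreover have "T y \<in> M" if "y \<in> M" for y
    using T(1) that by blast
  ultimately show ?thesis
    using T(2) assms(2) by auto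
qed

lemma isometric_bij_open_image:
  assumes "isometric_bij T" "openin mtopology U"
  shows "openin mtopology (T ` U)"
  unfolding openin_mtopology
proof (intro conjI allI impI)
  have U: "U \<subseteq> M"
    using assms(2) openin_subset by fastforce
  then show "T ` U \<subseteq> M"
    using assms(1) by (auto simp: isometric_bij_def bij_betw_def)
  fix y assume "y \<in> T ` U"
  then obtain x where x: "x \<in> U" "y = T x"
    by blast
  then obtain r where "r > 0" "mball x r \<subseteq> U"
    using assms(2) unfolding openin_mtopology by blast
  then show "\<exists>r>0. mball y r \<subseteq> T ` U"
    using isometric_bij_image_mball [OF assms(1), of x r] x U by (metis image_mono subsetD)
qed

lemma outer_isometric_image_le:
  assumes T: "isometric_bij T" and E: "E \<subseteq> M"
  shows "outer (T ` E) \<le> outer E"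
  unfolding outer_def [of E]
proof (rule INF_greatest, clarify)
  fix U assume U: "openin mtopology U" "E \<subseteq> U"
  let ?S = "inv_into M T"
  have S: "isometric_bij ?S"
    by (rule isometric_bij_inv [OF T])
  have UM: "U \<subseteq> M"
    using U(1) openin_subset by fastforce
  have bij: "bij_betw T M M" "bij_betw ?S M M"
    using S T by (auto simp: isometric_bij_def)
  have TS: "T ` ?S ` A = A" if "A \<subseteq> M" for A
    using that bij(1) by (simp add: bij_betw_def image_inv_into_cancel)
  have ST: "?S ` T ` A = A" if "A \<subseteq> M" for A
    using that bij(1) by (simp add: bij_betw_def)
  have "outer (T ` E) \<le> open_content (T ` U)"
    using isometric_bij_open_image [OF T U(1)] U(2)
    by (metis image_mono outer_mono outer_open)
  also have "\<dots> \<le> open_content U"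
    unfolding open_content_def [of "T ` U"]
  proof (rule SUP_least, clarify)
    fix A assume A: "well_inside A (T ` U)"
    have AM: "A \<subseteq> M"
      using A by (auto simp: well_inside_def)
    obtain \<delta> where \<delta>: "\<delta> > 0" "\<And>a. a \<in> A \<Longrightarrow> mball a \<delta> \<subseteq> T ` U"
      using A by (auto simp: well_inside_def)
    have "mball (?S a) \<delta> \<subseteq> U" if "a \<in> A" for a
      using image_mono [OF \<delta>(2) [OF that], of ?S] isometric_bij_image_mball [OF S, of a \<delta>]
        that AM ST [OF UM] by auto
    moreover have "?S ` A \<subseteq> M"
      using AM bij(2) by (auto simp: bij_betw_def)
    ultimately have "well_inside (?S ` A) U"
      using \<delta>(1) unfolding well_inside_def by blast
    then have "ennreal (l (?S ` A)) \<le> open_content U"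
      by (rule le_open_content)
    moreover have "l A \<le> l (?S ` A)"
      using l_isometric_image [OF T \<open>?S ` A \<subseteq> M\<close>] TS [OF AM] by simp
    ultimately show "ennreal (l A) \<le> open_content U"
      by (meson ennreal_leI order_trans)
  qed
  finally show "outer (T ` E) \<le> open_content U" .
qed

lemma outer_isometric_image:
  assumes T: "isometric_bij T" and E: "E \<subseteq> M"
  shows "outer (T ` E) = outer E"
proof (rule antisym)
  have bij: "bij_betw T M M"
    using T by (auto simp: isometric_bij_def)
  then have "T ` E \<subseteq> M" "inv_into M T ` T ` E = E"
    using E by (auto simp: bij_betw_def)
  then show "outer E \<le> outer (T ` E)"
    using outer_isometric_image_le [OF isometric_bij_inv [OF T], of "T ` E"] by simp
qed (rule outer_isometric_image_le [OF assms])

text \<open>Invariance is formulated with images, and \<open>emeasure\<close> is 0 off the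
  measurable sets, so \<open>emeasure\<close> can be identified with \<open>outer\<close> on an
  image only once the image is known to be Borel. Injectivity of \<open>T\<close> handles
  complements.\<close>

lemma isometric_bij_image_borel:
  assumes T: "isometric_bij T" and E: "E \<in> sigma_sets M {U. openin mtopology U}"
  shows "T ` E \<in> sigma_sets M {U. openin mtopology U}"
  using E
proof (induction rule: sigma_sets.induct)
  case (Basic a)
  then show ?case
    using isometric_bij_open_image [OF T] by (auto intro: sigma_sets.Basic)
next
  case (Compl a)
  have "a \<subseteq> M"
    by (rule sigma_sets_into_sp [OF openin_mtopology_subset_Pow Compl.hyps])
  moreover have "inj_on T M" "T ` M = M"
    using T by (auto simp: isometric_bij_def bij_betw_def)
  ultimately have "T ` (M - a) = M - T ` a"
    using inj_on_image_set_diff [of T M M a] by simp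
  then show ?case
    using sigma_sets.Compl [OF Compl.IH] by simp
next
  case (Union a)
  then show ?case
    unfolding image_UN by (intro sigma_sets.Union) simp
qed (simp add: sigma_sets.Empty)

end

lemma (in compact_metric_space) isometry_invariant_measure_exists:
  "\<exists>N. space N = M \<and> sets N = sigma_sets M {U. openin mtopology U} \<and> emeasure N M = 1 \<and>
       (\<forall>T. isometric_bij T \<longrightarrow> (\<forall>A\<in>sets N. emeasure N (T ` A) = emeasure N A)) \<and>
       (\<forall>A\<in>sets N. emeasure N A = (INF U\<in>{U. openin mtopology U \<and> A \<subseteq> U}. emeasure N U))"
proof -
  obtain l where "invariant_content M d l"
    using invariant_content_exists ..
  then interpret invariant_content M d l .
  define N where "N = measure_of M {U. openin mtopology U} outer"
  have space: "space N = M"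
    by (simp add: N_def space_measure_of openin_mtopology_subset_Pow)
  have sets: "sets N = sigma_sets M {U. openin mtopology U}"
    by (simp add: N_def sets_measure_of openin_mtopology_subset_Pow)
  have emeasure: "emeasure N A = outer A" if "A \<in> sets N" for A
    using measure_space_outer that
    by (intro emeasure_measure_of [OF N_def])
       (auto simp: measure_space_def sets openin_mtopology_subset_Pow)
  have open_sets: "U \<in> sets N" if "openin mtopology U" for U
    using that by (auto simp: sets)
  have "emeasure N M = 1"
    using open_sets [OF open_in_mspace]
    by (simp add: emeasure outer_open open_content_space)
  moreover have "emeasure N (T ` A) = emeasure N A" if "isometric_bij T" "A \<in> sets N" for T A
  proof -
    have "T ` A \<in> sets N"
      using isometric_bij_image_borel that by (simp add: sets)
    moreover have "A \<subseteq> M"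
      using sets.sets_into_space [OF that(2)] space by simp
    ultimately show ?thesis
      using that by (simp add: emeasure outer_isometric_image)
  qed
  \<comment> \<open>Outer regularity is the definition of \<open>outer\<close>, because
    \<open>outer\<close> and \<open>open_content\<close> agree on open sets.\<close>
  moreover have "emeasure N A = (INF U\<in>{U. openin mtopology U \<and> A \<subseteq> U}. emeasure N U)"
    if "A \<in> sets N" for A
    unfolding emeasure [OF that] outer_def [of A]
    by (intro INF_cong) (auto simp: emeasure open_sets outer_open)
  ultimately show ?thesis
    using space sets by blast
qed

section \<open>Haar measure and aperiodicity\<close>

lemma normalized_Haar_measure_exists:
  fixes X (structure)
  assumes "group X" and "compact_metric_space (carrier X) d"
    and top: "gtop X = Metric_space.mtopology (carrier X) d"
    and invariant: "\<And>x y z. \<lbrakk>x \<in> carrier X; y \<in> carrier X; z \<in> carrier X\<rbrakk> \<Longrightarrow> d (z \<otimes> x) (z \<otimes> y) = d x y"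
  shows "\<exists>N. is_normalized_Haar X N"
proof -
  interpret group X by fact
  interpret compact_metric_space "carrier X" d by fact
  have "isometric_bij (\<lambda>y. x \<otimes> y)" if "x \<in> carrier X" for x
    unfolding isometric_bij_def
  proof
    show "bij_betw (\<lambda>y. x \<otimes> y) (carrier X) (carrier X)"
      using that by (intro bij_betw_byWitness [where f' = "\<lambda>y. inv x \<otimes> y"])
        (auto simp flip: m_assoc)
  qed (use that invariant in auto)
  then show ?thesis
    using isometry_invariant_measure_exists unfolding is_normalized_Haar_def top by blast
qed

lemma
  assumes "is_normalized_Haar X N"
  shows normalized_Haar_space: "space N = carrier X"
    and normalized_Haar_open_sets: "openin (gtop X) U \<Longrightarrow> U \<in> sets N"
    and normalized_Haar_total: "emeasure N (carrier X) = 1"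
    and normalized_Haar_translation:
      "\<lbrakk>x \<in> carrier X; A \<in> sets N\<rbrakk> \<Longrightarrow> emeasure N ((\<lambda>y. x \<otimes>\<^bsub>X\<^esub> y) ` A) = emeasure N A"
  using assms unfolding is_normalized_Haar_def by blast+

lemma Haar_normalized: "\<exists>N. is_normalized_Haar X N \<Longrightarrow> is_normalized_Haar X (Haar X)"
  unfolding Haar_def by (rule someI_ex)

lemma continuous_left_translation:
  assumes "topological_group X" "x \<in> carrier X"
  shows "continuous_map (gtop X) (gtop X) (\<lambda>y. x \<otimes>\<^bsub>X\<^esub> y)"
proof -
  have "continuous_map (prod_topology (gtop X) (gtop X)) (gtop X) (\<lambda>(x, y). x \<otimes>\<^bsub>X\<^esub> y)"
    and "topspace (gtop X) = carrier X"
    using assms(1) by (auto simp: topological_group_def)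
  then have "continuous_map (gtop X) (gtop X) ((\<lambda>(x, y). x \<otimes>\<^bsub>X\<^esub> y) \<circ> (\<lambda>y. (x, y)))"
    using assms(2) by (intro continuous_map_compose) (auto simp: continuous_map_pairwise o_def)
  then show ?thesis
    by (simp add: o_def)
qed

text \<open>The translates of \<open>U\<close> cover the group and by compactness finitely many
  suffice; if \<open>U\<close> were null, the whole group would be null, against total mass
  1.\<close>

lemma emeasure_normalized_Haar_open_pos:
  fixes X (structure)
  assumes X: "topological_group X" "compact_space (gtop X)" and N: "is_normalized_Haar X N"
    and U: "openin (gtop X) U" "U \<noteq> {}"
  shows "emeasure N U \<noteq> 0"
proof
  assume 0: "emeasure N U = 0"
  interpret group X
    using X by (simp add: topological_group_def)
  have ts: "topspace (gtop X) = carrier X"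
    using X by (simp add: topological_group_def)
  have UX: "U \<subseteq> carrier X"
    using openin_subset [OF U(1)] ts by simp
  note open_sets = normalized_Haar_open_sets [OF N]
  have translate_eq: "(\<lambda>y. x \<otimes> y) ` U = {y \<in> carrier X. inv x \<otimes> y \<in> U}" if "x \<in> carrier X" for x
  proof (intro equalityI subsetI)
    fix y assume y: "y \<in> {y \<in> carrier X. inv x \<otimes> y \<in> U}"
    then have "y = x \<otimes> (inv x \<otimes> y)"
      using that by (simp flip: m_assoc)
    then show "y \<in> (\<lambda>y. x \<otimes> y) ` U"
      using y by blast
  qed (use that UX in \<open>auto simp flip: m_assoc\<close>)
  have openT: "openin (gtop X) ((\<lambda>y. x \<otimes> y) ` U)" if "x \<in> carrier X" for x
    using openin_continuous_map_preimage [OF continuous_left_translation [OF X(1), of "inv x"] U(1)]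
      that ts by (simp add: translate_eq)
  have null: "(\<lambda>y. x \<otimes> y) ` U \<in> null_sets N" if "x \<in> carrier X" for x
    using normalized_Haar_translation [OF N that open_sets [OF U(1)]] 0 open_sets [OF openT [OF that]]
    by (simp add: null_sets_def)
  let ?\<U> = "(\<lambda>x. (\<lambda>y. x \<otimes> y) ` U) ` carrier X"
  obtain u where u: "u \<in> U"
    using U(2) by blast
  have "\<exists>\<F>. finite \<F> \<and> \<F> \<subseteq> ?\<U> \<and> topspace (gtop X) \<subseteq> \<Union>\<F>"
  proof (rule X(2) [unfolded compact_space_alt, rule_format], intro conjI ballI subsetI)
    fix x assume "x \<in> topspace (gtop X)"
    then have x: "x \<in> carrier X"
      by (simp add: ts)
    \<comment> \<open>Exhibits \<open>x\<close> as a point of the translate of \<open>U\<close> by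
      \<open>x \<otimes> inv u\<close>.\<close>
    then have "x = (x \<otimes> inv u) \<otimes> u" "x \<otimes> inv u \<in> carrier X"
      using u UX by (auto simp: m_assoc)
    then show "x \<in> \<Union>?\<U>"
      using u by blast
  qed (use openT in auto)
  then obtain \<F> where \<F>: "finite \<F>" "\<F> \<subseteq> ?\<U>" "carrier X \<subseteq> \<Union>\<F>"
    by (auto simp: ts)
  have "\<Union>\<F> \<in> null_sets N"
    using \<F>(1,2) null null_sets.finite_UN [of \<F> "\<lambda>F. F" N] by auto
  moreover have "carrier X \<in> sets N"
    using open_sets [OF openin_topspace] by (simp add: ts)
  ultimately have "emeasure N (carrier X) = 0"
    using \<F>(3) by (metis null_sets_subset null_setsD1)
  then show False
    using normalized_Haar_total [OF N] by simp
qed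

lemma continuous_map_compact_imp_bounded:
  fixes f :: "'a \<Rightarrow> 'b::metric_space"
  assumes "compact_space Y" "continuous_map Y euclidean f"
  shows "bounded (f ` topspace Y)"
  using image_compactin [of Y "topspace Y" euclidean f] assms
  by (simp add: compact_space_def compact_imp_bounded)

lemma continuous_imp_Riemann_integrable:
  assumes "compact_group X" "continuous_map (gtop X) euclidean f"
  shows "Riemann_integrable X f"
proof -
  have X: "compact_space (gtop X)" "topspace (gtop X) = carrier X"
    using assms(1) by (auto simp: compact_group_def topological_group_def)
  have "{x \<in> carrier X. \<not> topcontinuous_at (gtop X) euclidean f x} = {}"
    using assms(2) X(2) by (auto simp: continuous_map_eq_topcontinuous_at)
  then show ?thesis
    using continuous_map_compact_imp_bounded [OF X(1) assms(2)] X(2)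
    by (simp only: Riemann_integrable_def null_sets.empty_sets)
qed

text \<open>The set where \<open>g\<close> does not vanish is open, and the vanishing integral makes
  it null; a null open set is empty.\<close>

lemma continuous_L1_norm_eq_0:
  fixes g :: "'x \<Rightarrow> complex"
  assumes X: "compact_group X" and H: "is_normalized_Haar X (Haar X)"
    and g: "continuous_map (gtop X) euclidean g" and 0: "L1_norm X g = 0"
    and x: "x \<in> carrier X"
  shows "g x = 0"
proof (rule ccontr)
  assume "g x \<noteq> 0"
  let ?N = "Haar X"
  have cX: "compact_space (gtop X)" "topspace (gtop X) = carrier X" "topological_group X"
    using X by (auto simp: compact_group_def topological_group_def)
  note space = normalized_Haar_space [OF H] and open_sets = normalized_Haar_open_sets [OF H]
  have fin: "finite_measure ?N"
    using normalized_Haar_total [OF H] space by (intro finite_measureI) simp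
  have meas: "g \<in> borel_measurable ?N"
  proof (rule borel_measurableI)
    fix S :: "complex set" assume "open S"
    then have "openin (gtop X) {x \<in> topspace (gtop X). g x \<in> S}"
      using g by (intro openin_continuous_map_preimage) auto
    moreover have "g -` S \<inter> space ?N = {x \<in> topspace (gtop X). g x \<in> S}"
      using space cX by auto
    ultimately show "g -` S \<inter> space ?N \<in> sets ?N"
      using open_sets by simp
  qed
  obtain b where b: "\<And>y. y \<in> carrier X \<Longrightarrow> cmod (g y) \<le> b"
    using continuous_map_compact_imp_bounded [OF cX(1) g] cX(2) by (auto simp: bounded_iff)
  have int: "integrable ?N (\<lambda>y. cmod (g y))"
    using meas b space by (intro finite_measure.integrable_const_bound [OF fin, of _ b]) auto
  \<comment> \<open>As \<open>g\<close> is Borel, the completion in \<open>L1_norm\<close> does not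
    change the integral.\<close>
  have "(LINT y | ?N. cmod (g y)) = 0"
    using 0 meas by (simp add: L1_norm_def integral_completion)
  then have "AE y in ?N. cmod (g y) = 0"
    using integral_nonneg_eq_0_iff_AE [OF int] by simp
  moreover have open_V: "openin (gtop X) {y \<in> topspace (gtop X). g y \<in> - {0}}"
    using g by (intro openin_continuous_map_preimage) auto
  then have "{y \<in> space ?N. cmod (g y) \<noteq> 0} \<in> sets ?N"
    using open_sets cX(2) space by simp
  ultimately have "emeasure ?N {y \<in> space ?N. cmod (g y) \<noteq> 0} = 0"
    using AE_iff_measurable [of "{y \<in> space ?N. cmod (g y) \<noteq> 0}" ?N "\<lambda>y. cmod (g y) = 0"] by simp
  then show False
    using emeasure_normalized_Haar_open_pos [OF cX(3,1) H open_V] \<open>g x \<noteq> 0\<close> x cX(2) space by auto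
qed

text \<open>Checking pointwise periods is enough because \<open>f\<close> minus a translate of
  \<open>f\<close> is again continuous, so it vanishes everywhere once its norm does.\<close>

lemma continuous_aperiodicI:
  fixes X (structure)
  assumes X: "compact_group X" and H: "is_normalized_Haar X (Haar X)"
    and f: "continuous_map (gtop X) euclidean f"
    and period: "\<And>x. \<lbrakk>x \<in> carrier X; \<And>y. y \<in> carrier X \<Longrightarrow> f (x \<otimes> y) = f y\<rbrakk> \<Longrightarrow> x = \<one>"
  shows "aperiodic X f"
  unfolding aperiodic_def
proof (intro equalityI subsetI)
  interpret group X
    using X by (simp add: compact_group_def topological_group_def)
  have tg: "topological_group X"
    using X by (simp add: compact_group_def)
  fix x
  {
    assume "x \<in> {x \<in> carrier X. L1_norm X (\<lambda>y. f y - translate X x f y) = 0}"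
    then have x: "x \<in> carrier X" and 0: "L1_norm X (\<lambda>y. f y - translate X x f y) = 0"
      by auto
    have "continuous_map (gtop X) euclidean (f \<circ> (\<lambda>y. x \<otimes> y))"
      by (rule continuous_map_compose [OF continuous_left_translation [OF tg x] f])
    then have "continuous_map (gtop X) euclidean (\<lambda>y. f y - translate X x f y)"
      using f by (auto simp: translate_def o_def intro: continuous_map_diff)
    then have "f (x \<otimes> y) = f y" if "y \<in> carrier X" for y
      using continuous_L1_norm_eq_0 [OF X H _ 0 that] by (simp add: translate_def)
    then show "x \<in> {\<one>}"
      using period [OF x] by blast
  }
  {
    assume "x \<in> {\<one>}"
    moreover have "L1_norm X (\<lambda>y. f y - translate X \<one> f y) = (LINT y | completion (Haar X). 0)"
      unfolding L1_norm_def using normalized_Haar_space [OF H]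
      by (intro Bochner_Integration.integral_cong) (auto simp: translate_def)
    ultimately show "x \<in> {x \<in> carrier X. L1_norm X (\<lambda>y. f y - translate X x f y) = 0}"
      by simp
  }
qed

section \<open>The quotient of a compact abelian group by the periods of a function\<close>

locale compact_group_function =
  fixes B :: "'b topgroup" (structure) and f :: "'b \<Rightarrow> complex"
  assumes compact_group: "compact_group B" and comm: "comm_group B"
    and continuous: "continuous_map (gtop B) euclidean f"

sublocale compact_group_function \<subseteq> comm_group B
  by (rule comm)

context compact_group_function
begin

text \<open>The uniform distance between the translates of \<open>f\<close> by \<open>x\<close> and
  by \<open>y\<close>. It is a pseudometric that vanishes exactly when \<open>x\<close> and
  \<open>y\<close> lie in one coset of the periods, so the quotient is the orbit of \<open>f\<close>
  under translation with the uniform metric.\<close>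

definition tdist :: "'b \<Rightarrow> 'b \<Rightarrow> real" where
  "tdist x y = (SUP z\<in>carrier B. cmod (f (x \<otimes> z) - f (y \<otimes> z)))"

lemma
  shows topological_group: "topological_group B"
    and compact_space: "compact_space (gtop B)"
    and topspace_eq: "topspace (gtop B) = carrier B"
  using compact_group by (auto simp: compact_group_def topological_group_def)

lemma tdist_upper:
  assumes "x \<in> carrier B" "y \<in> carrier B" "z \<in> carrier B"
  shows "cmod (f (x \<otimes> z) - f (y \<otimes> z)) \<le> tdist x y"
proof -
  obtain b where b: "\<And>x. x \<in> carrier B \<Longrightarrow> cmod (f x) \<le> b"
    using continuous_map_compact_imp_bounded [OF compact_space continuous] topspace_eq
    by (auto simp: bounded_iff)
  have "cmod (f (x \<otimes> w) - f (y \<otimes> w)) \<le> b + b" if "w \<in> carrier B" for w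
    using norm_triangle_ineq4 [of "f (x \<otimes> w)" "f (y \<otimes> w)"] b [of "x \<otimes> w"] b [of "y \<otimes> w"]
      assms that by simp
  then show ?thesis
    unfolding tdist_def using assms(3) by (intro cSUP_upper bdd_aboveI2) auto
qed

lemma tdist_least:
  assumes "\<And>z. z \<in> carrier B \<Longrightarrow> cmod (f (x \<otimes> z) - f (y \<otimes> z)) \<le> c"
  shows "tdist x y \<le> c"
  unfolding tdist_def using assms one_closed by (intro cSUP_least) auto

lemma tdist_nonneg: "x \<in> carrier B \<Longrightarrow> y \<in> carrier B \<Longrightarrow> 0 \<le> tdist x y"
  using tdist_upper [of x y \<one>] norm_ge_zero order_trans by blast

lemma tdist_commute: "tdist x y = tdist y x"
  by (simp add: tdist_def norm_minus_commute)

lemma tdist_triangle: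
  assumes "x \<in> carrier B" "y \<in> carrier B" "z \<in> carrier B"
  shows "tdist x z \<le> tdist x y + tdist y z"
proof (rule tdist_least)
  fix w assume "w \<in> carrier B"
  then show "cmod (f (x \<otimes> w) - f (z \<otimes> w)) \<le> tdist x y + tdist y z"
    using tdist_upper [of x y w] tdist_upper [of y z w] assms
      norm_triangle_ineq [of "f (x \<otimes> w) - f (y \<otimes> w)" "f (y \<otimes> w) - f (z \<otimes> w)"] by simp
qed

lemma tdist_eq_0D:
  assumes "tdist x y = 0" "x \<in> carrier B" "y \<in> carrier B" "z \<in> carrier B"
  shows "f (x \<otimes> z) = f (y \<otimes> z)"
  using tdist_upper [of x y z] assms by simp

text \<open>Commutativity moves \<open>w\<close> into the variable over which the supremum is taken.
  The converse inequality comes from translating back by \<open>inv w\<close>.\<close>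

lemma tdist_translate_le:
  assumes "w \<in> carrier B" "x \<in> carrier B" "y \<in> carrier B"
  shows "tdist (w \<otimes> x) (w \<otimes> y) \<le> tdist x y"
proof (rule tdist_least)
  fix z assume z: "z \<in> carrier B"
  have "w \<otimes> x \<otimes> z = x \<otimes> (w \<otimes> z)" "w \<otimes> y \<otimes> z = y \<otimes> (w \<otimes> z)"
    using assms z by (simp_all add: m_ac)
  then show "cmod (f (w \<otimes> x \<otimes> z) - f (w \<otimes> y \<otimes> z)) \<le> tdist x y"
    using tdist_upper [of x y "w \<otimes> z"] assms z by simp
qed

lemma tdist_translate:
  assumes "w \<in> carrier B" "x \<in> carrier B" "y \<in> carrier B"
  shows "tdist (w \<otimes> x) (w \<otimes> y) = tdist x y"
proof (rule antisym [OF tdist_translate_le [OF assms]])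
  show "tdist x y \<le> tdist (w \<otimes> x) (w \<otimes> y)"
    using tdist_translate_le [of "inv w" "w \<otimes> x" "w \<otimes> y"] assms by (simp flip: m_assoc)
qed

text \<open>Tube lemma: by compactness of the group, the bound \<open>\<epsilon> / 2\<close> at \<open>x\<close> persists on a
  neighbourhood of \<open>x\<close> uniformly in the second factor.\<close>

lemma tdist_continuous:
  assumes x: "x \<in> carrier B" and "\<epsilon> > 0"
  shows "\<exists>U. openin (gtop B) U \<and> x \<in> U \<and> (\<forall>y\<in>U. tdist x y < \<epsilon>)"
proof -
  let ?P = "prod_topology (gtop B) (gtop B)"
  have mult: "continuous_map ?P (gtop B) (\<lambda>(x, y). x \<otimes> y)"
    using topological_group by (simp add: topological_group_def)
  have c1: "continuous_map ?P euclidean (\<lambda>p. f (fst p \<otimes> snd p))"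
    using continuous_map_compose [OF mult continuous] by (simp add: o_def case_prod_unfold)
  have c2: "continuous_map ?P euclidean (\<lambda>p. f (x \<otimes> snd p))"
    using continuous_map_compose [OF continuous_map_compose [OF continuous_map_snd
        continuous_left_translation [OF topological_group x]] continuous]
    by (simp add: o_def)
  \<comment> \<open>The bad pairs form a closed set, and projection along the compact second factor
    maps it to a closed set; the complement is the neighbourhood sought. Taking
    \<open>\<epsilon> / 2\<close> keeps the final inequality strict after the supremum.\<close>
  define C where "C = {p \<in> topspace ?P. cmod (f (fst p \<otimes> snd p) - f (x \<otimes> snd p)) \<in> {\<epsilon> / 2..}}"
  have "continuous_map ?P euclidean (\<lambda>p. cmod (f (fst p \<otimes> snd p) - f (x \<otimes> snd p)))"
    by (intro continuous_map_norm continuous_map_diff c1 c2)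
  then have "closedin ?P C"
    unfolding C_def by (rule closedin_continuous_map_preimage) simp
  then have cl: "closedin (gtop B) (fst ` C)"
    using Abstract_Topological_Spaces.closed_map_fst [OF compact_space, of "gtop B"]
    by (simp add: closed_map_def)
  show ?thesis
  proof (intro exI conjI ballI)
    show "openin (gtop B) (carrier B - fst ` C)"
      using openin_diff [OF openin_topspace cl] by (simp add: topspace_eq)
    show "x \<in> carrier B - fst ` C"
      using assms by (auto simp: C_def)
    fix y assume y: "y \<in> carrier B - fst ` C"
    have "tdist x y \<le> \<epsilon> / 2"
    proof (rule tdist_least)
      fix z assume "z \<in> carrier B"
      then have "(y, z) \<in> topspace ?P" "(y, z) \<notin> C"
        using y by (auto simp: topspace_eq image_iff)
      then show "cmod (f (x \<otimes> z) - f (y \<otimes> z)) \<le> \<epsilon> / 2"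
        by (auto simp: C_def norm_minus_commute)
    qed
    then show "tdist x y < \<epsilon>"
      using \<open>\<epsilon> > 0\<close> by simp
  qed
qed

end

text \<open>Only the fibres of \<open>q\<close> are prescribed: they are the cosets of the period
  group. The type in which the quotient lives remains free.\<close>

locale period_quotient = compact_group_function +
  fixes q :: "'a \<Rightarrow> 'x"
  assumes q_eq_iff: "\<lbrakk>x \<in> carrier B; y \<in> carrier B\<rbrakk> \<Longrightarrow> q x = q y \<longleftrightarrow> tdist x y = 0"
begin

definition rep :: "'x \<Rightarrow> 'a" where
  "rep = inv_into (carrier B) q"

definition qdist :: "'x \<Rightarrow> 'x \<Rightarrow> real" where
  \<comment> \<open>The absolute value matters only off the carrier: \<open>Metric_space\<close> demands a nonnegative
    distance for all arguments.\<close>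
  "qdist a b = \<bar>tdist (rep a) (rep b)\<bar>"

definition Q :: "'x topgroup" where
  "Q = \<lparr>carrier = q ` carrier B, monoid.mult = (\<lambda>a b. q (rep a \<otimes> rep b)), one = q \<one>,
        gtop = Metric_space.mtopology (q ` carrier B) qdist\<rparr>"

definition qfun :: "'x \<Rightarrow> complex" where
  "qfun a = f (rep a)"

lemma carrier_Q [simp]: "carrier Q = q ` carrier B"
  and one_Q [simp]: "\<one>\<^bsub>Q\<^esub> = q \<one>"
  and gtop_Q: "gtop Q = Metric_space.mtopology (q ` carrier B) qdist"
  by (simp_all add: Q_def)

lemma rep_closed: "a \<in> q ` carrier B \<Longrightarrow> rep a \<in> carrier B"
  unfolding rep_def by (rule inv_into_into)

lemma q_rep: "a \<in> q ` carrier B \<Longrightarrow> q (rep a) = a"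
  unfolding rep_def by (rule f_inv_into_f)

lemma tdist_rep: "x \<in> carrier B \<Longrightarrow> tdist (rep (q x)) x = 0"
  using q_eq_iff [of "rep (q x)" x] rep_closed [of "q x"] q_rep [of "q x"] by simp

text \<open>Points at distance 0 have the same distance to any third point, so the choice of
  representatives is immaterial.\<close>

lemma qdist_q: 
  assumes "x \<in> carrier B" "y \<in> carrier B"
  shows "qdist (q x) (q y) = tdist x y"
proof -
  have r: "rep (q x) \<in> carrier B" "rep (q y) \<in> carrier B"
    using assms by (simp_all add: rep_closed)
  have "tdist x y = tdist (rep (q x)) y"
    using tdist_triangle [of x "rep (q x)" y] tdist_triangle [of "rep (q x)" x y] r assms
      tdist_rep [of x] by (simp add: tdist_commute [of x])
  also have "\<dots> = tdist (rep (q x)) (rep (q y))"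
    using tdist_triangle [of "rep (q x)" "rep (q y)" y] tdist_triangle [of "rep (q x)" y "rep (q y)"]
      r assms tdist_rep [of y] by (simp add: tdist_commute [of y])
  finally show ?thesis
    using tdist_nonneg [OF assms] by (simp add: qdist_def)
qed

text \<open>Changing one factor at a time, invariance bounds the distance of the two products by the
  distances of the factors from their representatives, which are 0.\<close>

lemma mult_q:
  assumes "x \<in> carrier B" "y \<in> carrier B"
  shows "q x \<otimes>\<^bsub>Q\<^esub> q y = q (x \<otimes> y)"
proof -
  let ?x = "rep (q x)" and ?y = "rep (q y)"
  have r: "?x \<in> carrier B" "?y \<in> carrier B"
    using assms by (simp_all add: rep_closed)
  have "tdist (?x \<otimes> ?y) (x \<otimes> y) \<le> tdist (?x \<otimes> ?y) (?x \<otimes> y) + tdist (?x \<otimes> y) (x \<otimes> y)"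
    using r assms by (intro tdist_triangle) auto
  also have "\<dots> = tdist ?y y + tdist ?x x"
    using r assms tdist_translate [of ?x ?y y] tdist_translate [of y ?x x] by (simp add: m_comm)
  also have "\<dots> = 0"
    using assms by (simp add: tdist_rep)
  finally have "tdist (?x \<otimes> ?y) (x \<otimes> y) = 0"
    using tdist_nonneg [of "?x \<otimes> ?y" "x \<otimes> y"] r assms by simp
  then show ?thesis
    using r assms by (simp add: Q_def q_eq_iff)
qed

lemma q_hom: "q \<in> hom B Q"
  by (auto simp: hom_def mult_q)

lemma comm_group_Q: "comm_group Q"
proof -
  \<comment> \<open>The homomorphic image comes as a group with carrier and unit updated;
    \<open>Q\<close> already has these, so the update is the identity.\<close>
  have "Q\<lparr>carrier := q ` carrier B, one := q \<one>\<rparr> = Q"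
    by (simp add: Q_def)
  then show ?thesis
    using hom_imp_img_comm_group [OF q_hom] by (simp only:)
qed

sublocale Q: comm_group Q
  by (rule comm_group_Q)

lemma Metric_space_Q: "Metric_space (q ` carrier B) qdist"
proof
  show "0 \<le> qdist a b" "qdist a b = qdist b a" for a b
    by (simp_all add: qdist_def tdist_commute)
  show "qdist a b = 0 \<longleftrightarrow> a = b" if "a \<in> q ` carrier B" "b \<in> q ` carrier B" for a b
    using that by (auto simp: qdist_q q_eq_iff)
  show "qdist a c \<le> qdist a b + qdist b c"
    if "a \<in> q ` carrier B" "b \<in> q ` carrier B" "c \<in> q ` carrier B" for a b c
    using that by (auto simp: qdist_q tdist_triangle)
qed

sublocale Q: Metric_space "q ` carrier B" qdist
  by (rule Metric_space_Q)

lemma qdist_translate: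
  assumes "a \<in> q ` carrier B" "b \<in> q ` carrier B" "c \<in> q ` carrier B"
  shows "qdist (c \<otimes>\<^bsub>Q\<^esub> a) (c \<otimes>\<^bsub>Q\<^esub> b) = qdist a b"
  using assms by (auto simp: mult_q qdist_q tdist_translate)

lemma continuous_q: "continuous_map (gtop B) (gtop Q) q"
  unfolding gtop_Q Q.continuous_map_to_metric
proof (intro ballI allI impI)
  fix x \<epsilon> assume "x \<in> topspace (gtop B)" "(\<epsilon>::real) > 0"
  then have x: "x \<in> carrier B"
    by (simp add: topspace_eq)
  obtain U where U: "openin (gtop B) U" "x \<in> U" "\<And>y. y \<in> U \<Longrightarrow> tdist x y < \<epsilon>"
    using tdist_continuous [OF x \<open>\<epsilon> > 0\<close>] by blast
  have "U \<subseteq> carrier B"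
    using openin_subset [OF U(1)] topspace_eq by simp
  then show "\<exists>U. openin (gtop B) U \<and> x \<in> U \<and> (\<forall>y\<in>U. q y \<in> Q.mball (q x) \<epsilon>)"
    using U x by (intro exI [of _ U]) (auto simp: qdist_q subset_iff)
qed

lemma compact_space_Q: "compact_space (gtop Q)"
proof -
  have "compactin (gtop Q) (q ` topspace (gtop B))"
    using compact_space continuous_q image_compactin unfolding compact_space_def by blast
  then show ?thesis
    by (simp add: compact_space_def gtop_Q topspace_eq)
qed

lemma compact_metric_space_Q: "compact_metric_space (q ` carrier B) qdist"
  using compact_space_Q one_closed
  by unfold_locales (auto simp: gtop_Q)

lemma qdist_mult_le:
  assumes "a \<in> q ` carrier B" "b \<in> q ` carrier B" "a' \<in> q ` carrier B" "b' \<in> q ` carrier B"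
  shows "qdist (a \<otimes>\<^bsub>Q\<^esub> b) (a' \<otimes>\<^bsub>Q\<^esub> b') \<le> qdist a a' + qdist b b'"
proof -
  have "qdist (a \<otimes>\<^bsub>Q\<^esub> b) (a' \<otimes>\<^bsub>Q\<^esub> b') \<le>
          qdist (a \<otimes>\<^bsub>Q\<^esub> b) (a \<otimes>\<^bsub>Q\<^esub> b') + qdist (a \<otimes>\<^bsub>Q\<^esub> b') (a' \<otimes>\<^bsub>Q\<^esub> b')"
    using assms Q.m_closed by (intro Q.triangle) auto
  also have "qdist (a \<otimes>\<^bsub>Q\<^esub> b) (a \<otimes>\<^bsub>Q\<^esub> b') = qdist b b'"
    using assms by (intro qdist_translate)
  also have "qdist (a \<otimes>\<^bsub>Q\<^esub> b') (a' \<otimes>\<^bsub>Q\<^esub> b') = qdist a a'"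
    using assms qdist_translate [of a a' b'] Q.m_comm [of b' a] Q.m_comm [of b' a'] by simp
  finally show ?thesis
    by simp
qed

text \<open>Translation by the product of \<open>a\<close> and \<open>b\<close> carries the inverse
  of \<open>a\<close> to \<open>b\<close> and the inverse of \<open>b\<close> to
  \<open>a\<close>.\<close>

lemma qdist_inv:
  assumes "a \<in> q ` carrier B" "b \<in> q ` carrier B"
  shows "qdist (inv\<^bsub>Q\<^esub> a) (inv\<^bsub>Q\<^esub> b) = qdist a b"
proof -
  have i: "inv\<^bsub>Q\<^esub> a \<in> q ` carrier B" "inv\<^bsub>Q\<^esub> b \<in> q ` carrier B" "a \<otimes>\<^bsub>Q\<^esub> b \<in> q ` carrier B"
    using assms Q.inv_closed Q.m_closed by auto
  have "a \<otimes>\<^bsub>Q\<^esub> b \<otimes>\<^bsub>Q\<^esub> inv\<^bsub>Q\<^esub> b = a"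
    using assms i Q.m_assoc [of a b "inv\<^bsub>Q\<^esub> b"] Q.r_inv [of b] Q.r_one [of a] by simp
  moreover have "a \<otimes>\<^bsub>Q\<^esub> b \<otimes>\<^bsub>Q\<^esub> inv\<^bsub>Q\<^esub> a = b"
    using assms i Q.m_comm [of a b] Q.m_assoc [of b a "inv\<^bsub>Q\<^esub> a"] Q.r_inv [of a] Q.r_one [of b]
    by simp
  ultimately show ?thesis
    using qdist_translate [OF i] Q.commute [of a b] by simp
qed

lemma topological_group_Q: "topological_group Q"
  unfolding topological_group_def
proof (intro conjI)
  show "group Q"
    by (rule Q.is_group)
  show ts: "topspace (gtop Q) = carrier Q"
    by (simp add: gtop_Q)
  show "continuous_map (prod_topology (gtop Q) (gtop Q)) (gtop Q) (\<lambda>(x, y). x \<otimes>\<^bsub>Q\<^esub> y)"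
    unfolding gtop_Q Q.continuous_map_to_metric
  proof (intro ballI allI impI)
    fix p \<epsilon>
    assume "p \<in> topspace (prod_topology Q.mtopology Q.mtopology)" and \<epsilon>: "(\<epsilon>::real) > 0"
    then obtain a b where p: "p = (a, b)" "a \<in> q ` carrier B" "b \<in> q ` carrier B"
      by auto
    have "a' \<otimes>\<^bsub>Q\<^esub> b' \<in> Q.mball (a \<otimes>\<^bsub>Q\<^esub> b) \<epsilon>"
      if "a' \<in> Q.mball a (\<epsilon> / 2)" "b' \<in> Q.mball b (\<epsilon> / 2)" for a' b'
      using that qdist_mult_le [of a b a' b'] Q.m_closed [of a b] Q.m_closed [of a' b'] by simp
    then show "\<exists>U. openin (prod_topology Q.mtopology Q.mtopology) U \<and> p \<in> U \<and>
        (\<forall>p'\<in>U. (case p' of (x, y) \<Rightarrow> x \<otimes>\<^bsub>Q\<^esub> y) \<in> Q.mball (case p of (x, y) \<Rightarrow> x \<otimes>\<^bsub>Q\<^esub> y) \<epsilon>)"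
      using p \<epsilon> by (intro exI [of _ "Q.mball a (\<epsilon> / 2) \<times> Q.mball b (\<epsilon> / 2)"])
        (auto simp: openin_prod_Times_iff simp del: Q.in_mball)
  qed
  show "continuous_map (gtop Q) (gtop Q) (m_inv Q)"
    unfolding gtop_Q Q.continuous_map_to_metric
  proof (intro ballI allI impI)
    fix a \<epsilon> assume "a \<in> topspace Q.mtopology" "(\<epsilon>::real) > 0"
    then show "\<exists>U. openin Q.mtopology U \<and> a \<in> U \<and> (\<forall>b\<in>U. inv\<^bsub>Q\<^esub> b \<in> Q.mball (inv\<^bsub>Q\<^esub> a) \<epsilon>)"
      using Q.inv_closed by (intro exI [of _ "Q.mball a \<epsilon>"]) (simp add: qdist_inv)
  qed
qed

lemma compact_group_Q: "compact_group Q"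
  using topological_group_Q compact_space_Q Q.Hausdorff_space_mtopology
  by (simp add: compact_group_def gtop_Q)

section \<open>The induced function on the quotient\<close>

lemma qfun_q:
  assumes "x \<in> carrier B"
  shows "qfun (q x) = f x"
  using tdist_eq_0D [OF tdist_rep [OF assms] _ assms one_closed] rep_closed [of "q x"] assms
  by (simp add: qfun_def)

text \<open>\<open>qfun\<close> is 1-Lipschitz: the value at \<open>z = \<one>\<close> is one of
  those over which \<open>tdist\<close> takes the supremum.\<close>

lemma continuous_qfun: "continuous_map (gtop Q) euclidean qfun"
  unfolding gtop_Q Q.continuous_map_from_metric
proof (intro conjI ballI allI impI)
  fix a U assume a: "a \<in> q ` carrier B" and "openin euclidean U \<and> qfun a \<in> U"
  then obtain r where r: "r > 0" "ball (qfun a) r \<subseteq> U"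
    by (auto simp: open_contains_ball)
  have "dist (qfun a) (qfun b) \<le> qdist a b" if b: "b \<in> q ` carrier B" for b
  proof -
    obtain x y where "x \<in> carrier B" "y \<in> carrier B" "a = q x" "b = q y"
      using a b by blast
    then show ?thesis
      using tdist_upper [of x y \<one>] by (simp add: qfun_q qdist_q dist_norm)
  qed
  then show "\<exists>r>0. \<forall>b. b \<in> q ` carrier B \<and> qdist a b < r \<longrightarrow> qfun b \<in> U"
    using r by (intro exI [of _ r]) fastforce
qed auto

lemma Haar_Q: "is_normalized_Haar Q (Haar Q)"
proof (intro Haar_normalized normalized_Haar_measure_exists [of Q qdist])
  show "qdist (z \<otimes>\<^bsub>Q\<^esub> x) (z \<otimes>\<^bsub>Q\<^esub> y) = qdist x y"
    if "x \<in> carrier Q" "y \<in> carrier Q" "z \<in> carrier Q" for x y z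
    using that by (simp add: qdist_translate)
qed (simp_all add: compact_metric_space_Q gtop_Q Q.is_group)

text \<open>A period \<open>q x\<close> of \<open>qfun\<close> lifts to a period \<open>x\<close> of
  \<open>f\<close>; then \<open>tdist x \<one> = 0\<close>, and \<open>q\<close> identifies
  \<open>x\<close> with the unit.\<close>

lemma aperiodic_qfun: "aperiodic Q qfun"
proof (rule continuous_aperiodicI [OF compact_group_Q Haar_Q continuous_qfun])
  fix a assume "a \<in> carrier Q" and period: "\<And>b. b \<in> carrier Q \<Longrightarrow> qfun (a \<otimes>\<^bsub>Q\<^esub> b) = qfun b"
  then obtain x where x: "x \<in> carrier B" "a = q x"
    by auto
  have "f (x \<otimes> z) = f (\<one> \<otimes> z)" if "z \<in> carrier B" for z
    using period [of "q z"] x that by (simp add: mult_q qfun_q)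
  then have "tdist x \<one> = 0"
    using x by (intro antisym tdist_least tdist_nonneg) auto
  then show "a = \<one>\<^bsub>Q\<^esub>"
    using x by (simp add: q_eq_iff)
qed

lemma group_compactification_Q:
  assumes "group_compactification G \<iota> B"
  shows "group_compactification G (q \<circ> \<iota>) Q"
  unfolding group_compactification_def
proof (intro conjI)
  have \<iota>: "\<iota> \<in> hom G B" "continuous_map (gtop G) (gtop B) \<iota>"
      "gtop B closure_of (\<iota> ` carrier G) = carrier B"
    using assms by (auto simp: group_compactification_def)
  show "compact_group Q"
    by (rule compact_group_Q)
  show "q \<circ> \<iota> \<in> hom G Q"
    by (rule Group.hom_compose [OF \<iota>(1) q_hom])
  show "continuous_map (gtop G) (gtop Q) (q \<circ> \<iota>)"
    using \<iota>(2) continuous_q by (rule continuous_map_compose)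
  have "carrier Q \<subseteq> gtop Q closure_of (q ` \<iota> ` carrier G)"
    using continuous_map_image_closure_subset [OF continuous_q, of "\<iota> ` carrier G"] \<iota>(3) by simp
  moreover have "gtop Q closure_of (q ` \<iota> ` carrier G) \<subseteq> carrier Q"
    using closure_of_subset_topspace [of "gtop Q"] by (simp add: gtop_Q)
  ultimately show "gtop Q closure_of ((q \<circ> \<iota>) ` carrier G) = carrier Q"
    by (simp add: image_comp)
qed

end

text \<open>In a Hausdorff group the elements commuting with \<open>x\<close> form a closed set, so
  \<open>x\<close> commutes with everything once it commutes with the dense image. This is applied
  to \<open>x\<close> in the image and, with the outcome, to arbitrary \<open>x\<close>.\<close>

lemma group_compactification_comm:
  assumes G: "comm_group G" and B: "group_compactification G \<iota> B"
  shows "comm_group B"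
proof -
  interpret G: comm_group G by fact
  have tg: "topological_group B" and H: "Hausdorff_space (gtop B)"
    and hom: "\<iota> \<in> hom G B" and dense: "gtop B closure_of (\<iota> ` carrier G) = carrier B"
    using B by (auto simp: group_compactification_def compact_group_def)
  interpret B: group B
    using tg by (simp add: topological_group_def)
  have ts: "topspace (gtop B) = carrier B"
    and mult: "continuous_map (prod_topology (gtop B) (gtop B)) (gtop B) (\<lambda>(x, y). x \<otimes>\<^bsub>B\<^esub> y)"
    using tg by (auto simp: topological_group_def)
  have right: "continuous_map (gtop B) (gtop B) (\<lambda>y. y \<otimes>\<^bsub>B\<^esub> x)" if "x \<in> carrier B" for x
  proof -
    have "continuous_map (gtop B) (gtop B) ((\<lambda>(x, y). x \<otimes>\<^bsub>B\<^esub> y) \<circ> (\<lambda>y. (y, x)))"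
      using that ts mult by (intro continuous_map_compose) (auto simp: continuous_map_pairwise o_def)
    then show ?thesis
      by (simp add: o_def)
  qed
  have commutes: "x \<otimes>\<^bsub>B\<^esub> y = y \<otimes>\<^bsub>B\<^esub> x"
    if x: "x \<in> carrier B" and y: "y \<in> carrier B"
      and on_image: "\<And>g. g \<in> carrier G \<Longrightarrow> x \<otimes>\<^bsub>B\<^esub> \<iota> g = \<iota> g \<otimes>\<^bsub>B\<^esub> x" for x y
  proof -
    have "closedin (gtop B) {y \<in> topspace (gtop B). x \<otimes>\<^bsub>B\<^esub> y = y \<otimes>\<^bsub>B\<^esub> x}"
      by (intro closedin_continuous_maps_eq [OF H] continuous_left_translation [OF tg x] right [OF x])
    moreover have "\<iota> ` carrier G \<subseteq> {y \<in> topspace (gtop B). x \<otimes>\<^bsub>B\<^esub> y = y \<otimes>\<^bsub>B\<^esub> x}"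
      using on_image hom ts by (auto simp: hom_def)
    ultimately have "gtop B closure_of (\<iota> ` carrier G) \<subseteq> {y \<in> topspace (gtop B). x \<otimes>\<^bsub>B\<^esub> y = y \<otimes>\<^bsub>B\<^esub> x}"
      by (rule closure_of_minimal [rotated])
    then show ?thesis
      using dense y by blast
  qed
  have image: "\<iota> g \<in> carrier B" if "g \<in> carrier G" for g
    using hom that by (auto simp: hom_def)
  have image_comm: "\<iota> g \<otimes>\<^bsub>B\<^esub> \<iota> h = \<iota> h \<otimes>\<^bsub>B\<^esub> \<iota> g" if "g \<in> carrier G" "h \<in> carrier G" for g h
    unfolding hom_mult [OF hom that, symmetric] hom_mult [OF hom that(2,1), symmetric]
      G.m_comm [OF that] ..
  have "\<iota> g \<otimes>\<^bsub>B\<^esub> y = y \<otimes>\<^bsub>B\<^esub> \<iota> g" if "g \<in> carrier G" "y \<in> carrier B" for g y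
    by (rule commutes [OF image [OF that(1)] that(2) image_comm [OF that(1)]])
  then have "x \<otimes>\<^bsub>B\<^esub> y = y \<otimes>\<^bsub>B\<^esub> x" if "x \<in> carrier B" "y \<in> carrier B" for x y
    using that by (intro commutes [of x y]) simp_all
  then show ?thesis
    by (rule B.group_comm_groupI)
qed

section \<open>Cosets encoded by families of subsets of \<open>G\<close>\<close>

theorem corollary5:
  fixes G :: "'g topgroup" and \<iota>b :: "'g \<Rightarrow> 'b" and bG :: "'b topgroup"
    and \<phi> :: "'g \<Rightarrow> complex"
  assumes "LCA_group G"
    and "Bohr_compactification G \<iota>b bG"
    and "\<phi> \<in> almost_periodic G \<iota>b bG"
  shows "\<exists>\<iota> (X :: 'g set set topgroup) \<phi>s.
           group_compactification G \<iota> X \<and> realization G \<iota> X \<phi> \<phi>s \<and> aperiodic X \<phi>s"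
proof -
  have gc: "group_compactification G \<iota>b bG"
    using assms(2) by (simp add: Bohr_compactification_def)
  have G: "comm_group G"
    using assms(1) by (simp add: LCA_group_def)
  obtain f where f: "continuous_map (gtop bG) euclidean f" "\<And>g. g \<in> carrier G \<Longrightarrow> \<phi> g = f (\<iota>b g)"
    using assms(3) by (auto simp: almost_periodic_def)
  interpret compact_group_function bG f
    using gc f(1) group_compactification_comm [OF G gc]
    by (simp add: compact_group_function_def group_compactification_def)
  have image: "\<iota>b g \<in> carrier bG" if "g \<in> carrier G" for g
    using gc that by (auto simp: group_compactification_def hom_def)
  \<comment> \<open>Density in the topology of \<open>bG\<close> passes to \<open>tdist\<close>,
    since each \<open>tdist\<close> ball around \<open>x\<close> contains a neighbourhood of
    \<open>x\<close>.\<close>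
  have dense: "\<exists>g\<in>carrier G. tdist (\<iota>b g) x < r" if x: "x \<in> carrier bG" and r: "r > 0" for x r
  proof -
    obtain U where U: "openin (gtop bG) U" "x \<in> U" "\<And>y. y \<in> U \<Longrightarrow> tdist x y < r"
      using tdist_continuous [OF x r] by blast
    moreover have "x \<in> gtop bG closure_of (\<iota>b ` carrier G)"
      using gc x by (simp add: group_compactification_def)
    ultimately obtain g where "g \<in> carrier G" "\<iota>b g \<in> U"
      by (auto simp: in_closure_of)
    then show ?thesis
      using U(3) tdist_commute by metis
  qed
  \<comment> \<open>The trace on \<open>G\<close> of the \<open>tdist\<close> ball of radius
    \<open>r\<close> around \<open>x\<close>. The family of these traces remembers \<open>x\<close>
    up to a period, because the image of \<open>G\<close> is dense.\<close>
  define S where "S r x = {g \<in> carrier G. tdist (\<iota>b g) x < r}" for r x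
  \<comment> \<open>Encodes the coset of \<open>x\<close> as an element of \<open>'g set set\<close>: if \<open>S \<delta> x = S r y\<close> with
    \<open>\<delta> = tdist x y / 2\<close>, then a point of the dense image close to \<open>y\<close> is within \<open>\<delta>\<close> of both.\<close>
  define q where "q x = {S r x | r. r > 0}" for x
  have S_mono: "S r x \<subseteq> S r y" if "x \<in> carrier bG" "y \<in> carrier bG" "tdist x y = 0" for x y r
  proof
    fix g assume "g \<in> S r x"
    then show "g \<in> S r y"
      using tdist_triangle [OF image that(1,2), of g] that(3) by (auto simp: S_def)
  qed
  have "q x = q y \<longleftrightarrow> tdist x y = 0" if xy: "x \<in> carrier bG" "y \<in> carrier bG" for x y
  proof
    assume "tdist x y = 0"
    then have "S r x = S r y" for r
      using S_mono xy by (intro equalityI) (auto simp: tdist_commute)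
    then show "q x = q y"
      by (simp add: q_def)
  next
    assume eq: "q x = q y"
    show "tdist x y = 0"
    proof (rule ccontr)
      assume "tdist x y \<noteq> 0"
      then have pos: "tdist x y / 2 > 0"
        using tdist_nonneg [OF xy] by simp
      then have "S (tdist x y / 2) x \<in> q y"
        using eq unfolding q_def by blast
      then obtain r where r: "r > 0" "S (tdist x y / 2) x = S r y"
        by (auto simp: q_def)
      obtain g where g: "g \<in> carrier G" "tdist (\<iota>b g) y < min r (tdist x y / 2)"
        using dense [OF xy(2), of "min r (tdist x y / 2)"] r(1) pos by auto
      then have "g \<in> S (tdist x y / 2) x"
        unfolding r(2) by (simp add: S_def)
      then show False
        using g tdist_triangle [OF xy(1) image xy(2), of g] by (simp add: S_def tdist_commute [of x])
    qed
  qed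
  then interpret period_quotient bG f q
    by unfold_locales
  have "realization G (q \<circ> \<iota>b) Q \<phi> qfun"
    unfolding realization_def
    using continuous_imp_Riemann_integrable [OF compact_group_Q continuous_qfun] f(2) image
    by (simp add: qfun_q)
  then show ?thesis
    using group_compactification_Q [OF gc] aperiodic_qfun by blast
qed

end
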